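(* Let $R(z,t)$ be a smooth one-parameter family of rational functions of $z$ with critical points $a_l=a_l(t)$ ($1\le l\le M$) and poles $b_j=b_j(t)$ ($1\le j\le N$), of fixed multiplicities and normalized as described in the context; in particular $$\sum_{k=1}^M (m_k-1)a_k-\sum_{j=1}^N (n_j+1)b_j=0 .$$ Let $A_l(t)=R(a_l(t),t)$ be the critical values. Then the critical points and the poles satisfy the system of differential equations $$\dot a_l=\frac{H_l^{(m_l-1)}(a_l)}{(m_l-1)!}\,\dot A_l+\sum_{k=1,\,k\ne l}^{M}\frac{G_{kl}^{(m_k-2)}(a_k)}{(m_k-2)!}\,\dot A_k\quad(1\le l\le M),\qquad \dot b_j=\sum_{k=1}^{M}\frac{I_{kj}^{(m_k-2)}(a_k)}{(m_k-2)!}\,\dot A_k\quad(1\le j\le N),$$ where $$H_l(x)=\frac{\prod_{j=1}^N (x-b_j)^{n_j+1}}{\prod_{k=1,\,k\ne l}^M (x-a_k)^{m_k-1}},\qquad G_{kl}(x)=\frac{H_k(x)}{x-a_l},\qquad I_{kj}(x)=\frac{H_k(x)}{x-b_j},$$ and the derivatives of $H_l$, $G_{kl}$, $I_{kj}$ are taken with respect to $x$ at fixed $t$.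
   Context: A dot denotes differentiation with respect to the real parameter $t$ (ranging over an interval); a prime denotes $\partial/\partial z$. Setting. Integers $m_l\ge 2$ ($1\le l\le M$) and $n_j\ge 1$ ($1\le j\le N$) are fixed, $m=\sum_{l=1}^M (m_l-1)$, $n=\sum_{j=1}^N(n_j+1)$. The points $a_1(t),\dots,a_M(t),b_1(t),\dots,b_N(t)\in\mathbb{C}$ are pairwise distinct for each $t$ and depend smoothly on $t$. For each $t$, $R(\cdot,t)$ is a (single-valued) rational function whose critical points in $\mathbb{C}$ are exactly the $a_l$, of order $m_l-1$, and whose poles in $\mathbb{C}$ are exactly the $b_j$, of order $n_j$, with $$R'(z,t)=\frac{\prod_{l=1}^M (z-a_l)^{m_l-1}}{\prod_{j=1}^N (z-b_j)^{n_j+1}} .$$ Since $R(\cdot,t)$ is single-valued, $m\ne n-1$. The additive constant is fixed as follows: - if $m>n$: $R(z,t)=\int_{a_1}^z \frac{\prod_l(\zeta-a_l)^{m_l-1}}{\prod_j(\zeta-b_j)^{n_j+1}}\,d\zeta$ (so $A_1\equiv 0$); - if $m<n-1$: $R(z,t)=\int_{\infty}^z \frac{\prod_l(\zeta-a_l)^{m_l-1}}{\prod_j(\zeta-b_j)^{n_j+1}}\,d\zeta$; - if $m=n$: $R(z,t)=z+\int_{\infty}^z \Bigl[\frac{\prod_l(\zeta-a_l)^{m_l-1}}{\prod_j(\zeta-b_j)^{n_j+1}}-1\Bigr]d\zeta$. *)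

theory Defs
  imports
    "HOL-Complex_Analysis.Complex_Analysis"
    "HOL-Computational_Algebra.Polynomial"
begin

text \<open>Infinite differentiability on a (nondegenerate) real interval, one-sided at end points
  belonging to the interval.\<close>

definition smooth_on_interval :: "real set \<Rightarrow> (real \<Rightarrow> 'a::real_normed_vector) \<Rightarrow> bool" where
  "smooth_on_interval T f \<longleftrightarrow>
     (\<exists>D. D 0 = f \<and> (\<forall>i::nat. \<forall>t\<in>T. (D i has_vector_derivative D (Suc i) t) (at t within T)))"

text \<open>The values at the zeros of the reduced denominator, i.e. at the poles, are irrelevant.\<close>

definition rational_function :: "(complex \<Rightarrow> complex) \<Rightarrow> bool" where
  "rational_function f \<longleftrightarrow>
     (\<exists>p q. q \<noteq> 0 \<and> coprime p q \<and> (\<forall>z. poly q z \<noteq> 0 \<longrightarrow> f z = poly p z / poly q z))"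

text \<open>\<open>I\<close> is the integral of \<open>f\<close> from \<open>p\<close> to \<open>z\<close>, taken along an arbitrary path in \<open>S\<close>.\<close>

definition has_integral_from ::
    "(complex \<Rightarrow> complex) \<Rightarrow> complex set \<Rightarrow> complex \<Rightarrow> complex \<Rightarrow> complex \<Rightarrow> bool" where
  "has_integral_from f S p z I \<longleftrightarrow>
     (\<forall>g. valid_path g \<and> path_image g \<subseteq> S \<and> pathstart g = p \<and> pathfinish g = z
        \<longrightarrow> (f has_contour_integral I) g)"

text \<open>\<open>I\<close> is the improper integral of \<open>f\<close> from \<open>\<infinity>\<close> to \<open>z\<close>: the limit of the integrals from
  \<open>w\<close> to \<open>z\<close> as \<open>w\<close> tends to \<open>\<infinity>\<close>, for an arbitrary choice of the paths in \<open>S\<close>.\<close>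

definition has_integral_from_infinity ::
    "(complex \<Rightarrow> complex) \<Rightarrow> complex set \<Rightarrow> complex \<Rightarrow> complex \<Rightarrow> bool" where
  "has_integral_from_infinity f S z I \<longleftrightarrow>
     (\<forall>g. (\<forall>w\<in>S. valid_path (g w) \<and> path_image (g w) \<subseteq> S \<and> pathstart (g w) = w
                 \<and> pathfinish (g w) = z)
        \<longrightarrow> ((\<lambda>w. contour_integral (g w) f) \<longlongrightarrow> I) at_infinity)"

definition crit_total :: "nat \<Rightarrow> (nat \<Rightarrow> nat) \<Rightarrow> nat" where
  "crit_total M m = (\<Sum>l=1..M. m l - 1)"

definition pole_total :: "nat \<Rightarrow> (nat \<Rightarrow> nat) \<Rightarrow> nat" where
  "pole_total N n = (\<Sum>j=1..N. n j + 1)"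

text \<open>In the following, \<open>a\<close> and \<open>b\<close> are the critical points and the poles at a fixed time.\<close>

definition R_prime ::
    "nat \<Rightarrow> nat \<Rightarrow> (nat \<Rightarrow> nat) \<Rightarrow> (nat \<Rightarrow> nat) \<Rightarrow> (nat \<Rightarrow> complex) \<Rightarrow> (nat \<Rightarrow> complex) \<Rightarrow> complex \<Rightarrow> complex"
  where "R_prime M N m n a b z =
    (\<Prod>l=1..M. (z - a l) ^ (m l - 1)) / (\<Prod>j=1..N. (z - b j) ^ (n j + 1))"

definition H_fun ::
    "nat \<Rightarrow> nat \<Rightarrow> (nat \<Rightarrow> nat) \<Rightarrow> (nat \<Rightarrow> nat) \<Rightarrow> (nat \<Rightarrow> complex) \<Rightarrow> (nat \<Rightarrow> complex)
      \<Rightarrow> nat \<Rightarrow> complex \<Rightarrow> complex"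
  where "H_fun M N m n a b l x =
    (\<Prod>j=1..N. (x - b j) ^ (n j + 1)) / (\<Prod>k\<in>{1..M} - {l}. (x - a k) ^ (m k - 1))"

definition G_fun ::
    "nat \<Rightarrow> nat \<Rightarrow> (nat \<Rightarrow> nat) \<Rightarrow> (nat \<Rightarrow> nat) \<Rightarrow> (nat \<Rightarrow> complex) \<Rightarrow> (nat \<Rightarrow> complex)
      \<Rightarrow> nat \<Rightarrow> nat \<Rightarrow> complex \<Rightarrow> complex"
  where "G_fun M N m n a b k l x = H_fun M N m n a b k x / (x - a l)"

definition I_fun ::
    "nat \<Rightarrow> nat \<Rightarrow> (nat \<Rightarrow> nat) \<Rightarrow> (nat \<Rightarrow> nat) \<Rightarrow> (nat \<Rightarrow> complex) \<Rightarrow> (nat \<Rightarrow> complex)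
      \<Rightarrow> nat \<Rightarrow> nat \<Rightarrow> complex \<Rightarrow> complex"
  where "I_fun M N m n a b k j x = H_fun M N m n a b k x / (x - b j)"

end

theory Submission
  imports Defs
begin

text \<open>
  The whole argument is one partial fraction expansion. Write \<open>f = R'\<close> and let \<open>\<Phi> = \<partial>R/\<partial>t\<close> at
  a fixed time. Differentiating the product formula for \<open>f\<close> in time gives \<open>\<Phi>' = f L\<close> with
  \<open>L = - \<Sum> (m\<^sub>l - 1) a\<^sub>l'/(z - a\<^sub>l) + \<Sum> (n\<^sub>j + 1) b\<^sub>j'/(z - b\<^sub>j)\<close>, where \<open>a\<^sub>l'\<close> and \<open>b\<^sub>j'\<close> are velocities.
  The quotient \<open>g = \<Phi>/f\<close> then behaves as follows.

  \<^item> At a pole \<open>b\<^sub>j\<close> it has the limit \<open>- b\<^sub>j'\<close>.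
  \<^item> At a critical point \<open>a\<^sub>k\<close> the function \<open>(\<Phi> - \<Phi>(a\<^sub>k))/f\<close> has the limit \<open>- a\<^sub>k'\<close>, and
    \<open>1/f = H\<^sub>k(z)/(z - a\<^sub>k)^(m\<^sub>k - 1)\<close>. So the principal part of \<open>g\<close> is \<open>\<Phi>(a\<^sub>k)\<close> times the principal part
    of that function.
  \<^item> At infinity it tends to \<open>0\<close>. The centring condition makes \<open>z L\<close> tend to \<open>0\<close>, and if \<open>f\<close> does not
    grow, the normalization of \<open>R\<close> at infinity makes \<open>\<Phi>\<close> tend to \<open>0\<close>.

  By Liouville's theorem \<open>g\<close> is the sum of its principal parts, and comparing the finite limits at the
  points \<open>a\<^sub>l\<close> and \<open>b\<^sub>j\<close> expresses the velocities through the numbers \<open>\<Phi>(a\<^sub>k)\<close>. This is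
  \<open>velocity_from_critical_values\<close>; the local limits are \<open>quotient_limit_at_divisor\<close> and
  \<open>quotient_limit_at_infinity\<close>, and \<open>principal_part_eq_higher_deriv\<close> identifies the values of the
  principal parts with the higher derivatives of \<open>H\<^sub>k(x)/(x - a\<^sub>l)\<close> and \<open>H\<^sub>k(x)/(x - b\<^sub>j)\<close>.
  Finally \<open>\<Phi>(a\<^sub>k)\<close> is the derivative of the critical value \<open>A\<^sub>k = R(a\<^sub>k(t), t)\<close>, because \<open>R' = 0\<close>
  at \<open>a\<^sub>k\<close> (\<open>moving_point_derivative\<close>).

  It remains to see that \<open>\<Phi>\<close> exists, as smoothness in time is only known for the points. Differences
  \<open>R(z\<^sub>2, t) - R(z\<^sub>1, t)\<close> are integrals of \<open>f\<close> along segments and can be differentiated under the integral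
  sign, so it is enough to have one \<open>z\<close> at which \<open>R(z, t)\<close> is differentiable. If \<open>f\<close> grows at infinity,
  \<open>z = a\<^sub>1\<close> will do since \<open>A\<^sub>1 = 0\<close>. Otherwise \<open>R\<close> is normalized at infinity, and
  \<open>mean_value_representation_at_infinity\<close> turns the improper integral into an integral over a circle.

  Zeros and poles of \<open>f\<close> play symmetric roles in all of this, so they are treated together, as points
  \<open>c\<^sub>i\<close> carrying a nonzero integer exponent \<open>e\<^sub>i\<close>.
\<close>

section \<open>Asymptotics of a function from those of its derivative\<close>

lemma tendsto_transform_eq:
  assumes "(f \<longlongrightarrow> l) F" "\<forall>\<^sub>F x in F. f x = g x" "l = l'"
  shows "(g \<longlongrightarrow> l') F"
  using assms Lim_transform_eventually by blast

lemma eventually_at_infinity_inverse: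
  "(\<forall>\<^sub>F z in at_infinity. P z) \<longleftrightarrow> (\<forall>\<^sub>F w in at 0. P (inverse w :: complex))"
  by (simp add: at_to_infinity eventually_filtermap)

text \<open>The mean value inequality along a ray, with \<open>\<epsilon> r\<^sup>p / p\<close> as the majorant.\<close>

lemma radial_growth_bound:
  fixes \<Psi> \<Psi>' :: "complex \<Rightarrow> complex" and p :: int
  assumes p: "p \<noteq> 0" and r: "0 < r\<^sub>1" "r\<^sub>1 < r\<^sub>2" and u: "norm u = 1"
    and der: "\<And>r. r \<in> {r\<^sub>1..r\<^sub>2} \<Longrightarrow> (\<Psi> has_field_derivative \<Psi>' (a + of_real r * u)) (at (a + of_real r * u))"
    and bnd: "\<And>r. r \<in> {r\<^sub>1..r\<^sub>2} \<Longrightarrow> norm (\<Psi>' (a + of_real r * u)) \<le> \<epsilon> * r powi (p - 1)"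
  shows "norm (\<Psi> (a + of_real r\<^sub>2 * u) - \<Psi> (a + of_real r\<^sub>1 * u))
           \<le> \<epsilon> / of_int p * (r\<^sub>2 powi p) - \<epsilon> / of_int p * (r\<^sub>1 powi p)"
proof -
  have g: "((\<lambda>r. a + complex_of_real r * u) has_vector_derivative u) (at r)" for r
    by (auto intro!: derivative_eq_intros)
  have D: "((\<lambda>r. \<Psi> (a + of_real r * u)) has_vector_derivative u * \<Psi>' (a + of_real r * u)) (at r)"
    if "r \<in> {r\<^sub>1..r\<^sub>2}" for r
    using field_vector_diff_chain_at[OF g der[OF that]] by (simp add: o_def)
  have P: "((\<lambda>r. \<epsilon> / of_int p * (r powi p)) has_vector_derivative \<epsilon> * r powi (p - 1)) (at r)"
    if "r \<in> {r\<^sub>1..r\<^sub>2}" for r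
    unfolding has_real_derivative_iff_has_vector_derivative[symmetric]
    using that r p by (auto intro!: derivative_eq_intros)
  show ?thesis
  proof (rule differentiable_bound_general[where f = "\<lambda>r. \<Psi> (a + complex_of_real r * u)"
        and \<phi> = "\<lambda>r. \<epsilon> / of_int p * (r powi p)"
        and f' = "\<lambda>r. u * \<Psi>' (a + complex_of_real r * u)"
        and \<phi>' = "\<lambda>r. \<epsilon> * r powi (p - 1)", OF r(2)])
    show "continuous_on {r\<^sub>1..r\<^sub>2} (\<lambda>r. \<Psi> (a + complex_of_real r * u))"
      by (rule continuous_at_imp_continuous_on) (use D has_vector_derivative_continuous in blast)
    show "continuous_on {r\<^sub>1..r\<^sub>2} (\<lambda>r. \<epsilon> / of_int p * (r powi p))"
      by (rule continuous_at_imp_continuous_on) (use P has_vector_derivative_continuous in blast)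
    fix r assume r: "r\<^sub>1 < r" "r < r\<^sub>2"
    show "((\<lambda>r. \<Psi> (a + complex_of_real r * u)) has_vector_derivative
        u * \<Psi>' (a + complex_of_real r * u)) (at r)"
      using D r by simp
    show "((\<lambda>r. \<epsilon> / of_int p * (r powi p)) has_vector_derivative \<epsilon> * r powi (p - 1)) (at r)"
      using P r by simp
    show "norm (u * \<Psi>' (a + complex_of_real r * u)) \<le> \<epsilon> * r powi (p - 1)"
      using bnd[of r] r u by (simp add: norm_mult)
  qed
qed

text \<open>One integrates along rays. For \<open>p > 0\<close> the ray starts at \<open>a\<close>, where \<open>\<Phi>\<close> vanishes. For \<open>p < 0\<close> it
  starts on a fixed small circle, on which \<open>\<Phi>\<close> is bounded and hence negligible against \<open>(z - a)\<^sup>p\<close>.\<close>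

lemma power_little_o_of_derivative:
  fixes \<Phi> \<Phi>' :: "complex \<Rightarrow> complex" and p :: int
  assumes p: "p \<noteq> 0"
    and der: "\<forall>\<^sub>F z in at a. (\<Phi> has_field_derivative \<Phi>' z) (at z)"
    and lim: "((\<lambda>z. \<Phi>' z / (z - a) powi (p - 1)) \<longlongrightarrow> 0) (at a)"
    and van: "p > 0 \<Longrightarrow> (\<Phi> \<longlongrightarrow> 0) (at a)"
  shows "((\<lambda>z. \<Phi> z / (z - a) powi p) \<longlongrightarrow> 0) (at a)"
proof -
  have key: "\<forall>\<^sub>F z in at a. norm (\<Phi> z / (z - a) powi p) \<le> 2 * \<epsilon>" if \<epsilon>: "\<epsilon> > 0" for \<epsilon> :: real
  proof -
    have "\<forall>\<^sub>F z in at a. (\<Phi> has_field_derivative \<Phi>' z) (at z) \<and> norm (\<Phi>' z / (z - a) powi (p - 1)) < \<epsilon>"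
      using der tendstoD[OF lim \<epsilon>] by eventually_elim (simp add: dist_norm)
    then obtain \<delta> where \<delta>: "\<delta> > 0" and d: "\<And>z. z \<noteq> a \<Longrightarrow> dist z a < \<delta> \<Longrightarrow>
        (\<Phi> has_field_derivative \<Phi>' z) (at z) \<and> norm (\<Phi>' z / (z - a) powi (p - 1)) < \<epsilon>"
      unfolding eventually_at by auto
    have b: "norm (\<Phi>' z) \<le> \<epsilon> * norm (z - a) powi (p - 1)" if "z \<noteq> a" "dist z a < \<delta>" for z
      using d[OF that] that(1) by (simp add: norm_divide norm_power_int divide_simps split: if_splits)
    have rad: "norm (\<Phi> (a + of_real r\<^sub>2 * u) - \<Phi> (a + of_real r\<^sub>1 * u))
           \<le> \<epsilon> / of_int p * (r\<^sub>2 powi p) - \<epsilon> / of_int p * (r\<^sub>1 powi p)"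
      if "0 < r\<^sub>1" "r\<^sub>1 < r\<^sub>2" "r\<^sub>2 < \<delta>" "norm u = 1" for r\<^sub>1 r\<^sub>2 u
    proof (rule radial_growth_bound[OF p that(1,2,4), where \<Psi>' = \<Phi>'])
      fix r assume r: "r \<in> {r\<^sub>1..r\<^sub>2}"
      have *: "a + of_real r * u \<noteq> a" "dist (a + of_real r * u) a < \<delta>"
        using r that by (auto simp: dist_norm norm_mult)
      show "(\<Phi> has_field_derivative \<Phi>' (a + of_real r * u)) (at (a + of_real r * u))"
        using d[OF *] by blast
      show "norm (\<Phi>' (a + of_real r * u)) \<le> \<epsilon> * r powi (p - 1)"
        using b[OF *] r that by (simp add: norm_mult)
    qed
    have polar: "z = a + of_real (norm (z - a)) * sgn (z - a)" "norm (sgn (z - a)) = 1"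
      if "z \<noteq> a" for z
      using that by (auto simp: sgn_eq norm_sgn norm_divide)
    show ?thesis
    proof (cases "p > 0")
      case True
      have "norm (\<Phi> z / (z - a) powi p) \<le> 2 * \<epsilon>" if z: "z \<noteq> a" "dist z a < \<delta>" for z
      proof -
        define r where "r = norm (z - a)"
        define u where "u = sgn (z - a)"
        have r: "r > 0" "r < \<delta>" and u: "norm u = 1" and zz: "z = a + of_real r * u"
          using z polar unfolding r_def u_def by (auto simp: dist_norm)
        have t: "((\<lambda>s. a + complex_of_real s * u) \<longlongrightarrow> a) (at_right 0)"
          by (auto intro!: tendsto_eq_intros)
        have "filterlim (\<lambda>s. a + complex_of_real s * u) (at a) (at_right 0)"
          unfolding filterlim_at using t u
          by (auto simp: eventually_at_filter intro!: always_eventually)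
        then have l: "((\<lambda>s. \<Phi> (a + of_real s * u)) \<longlongrightarrow> 0) (at_right (0::real))"
          using filterlim_compose van True by blast
        have "((\<lambda>s. norm (\<Phi> z - \<Phi> (a + of_real s * u))) \<longlongrightarrow> norm (\<Phi> z - 0)) (at_right (0::real))"
          by (intro tendsto_intros l)
        moreover have "\<forall>\<^sub>F s in at_right 0. norm (\<Phi> z - \<Phi> (a + of_real s * u)) \<le> \<epsilon> * r powi p"
          using eventually_at_right_real[OF r(1)]
        proof eventually_elim
          case (elim s)
          have "norm (\<Phi> z - \<Phi> (a + of_real s * u)) \<le> \<epsilon> / of_int p * (r powi p) - \<epsilon> / of_int p * (s powi p)"
            using rad[of s r u] elim r u zz by auto
          also have "\<dots> \<le> \<epsilon> / of_int p * (r powi p)" using elim \<epsilon> True by simp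
          also have "\<dots> \<le> \<epsilon> / 1 * (r powi p)"
            using True \<epsilon> r by (intro mult_right_mono divide_left_mono) auto
          finally show ?case by simp
        qed
        ultimately have "norm (\<Phi> z - 0) \<le> \<epsilon> * r powi p"
          by (intro tendsto_upperbound) auto
        moreover have rp: "r powi p > 0" using r by simp
        moreover have "\<epsilon> * r powi p \<le> 2 * \<epsilon> * r powi p"
          using \<epsilon> rp by (intro mult_right_mono) auto
        ultimately have "norm (\<Phi> z) / r powi p \<le> 2 * \<epsilon>"
          by (simp only: pos_divide_le_eq[OF rp]) simp
        then show ?thesis
          by (simp add: norm_divide norm_power_int r_def)
      qed
      then show ?thesis using \<delta> unfolding eventually_at by auto
    next
      case False
      then have p0: "p < 0" using p by simp
      define r0 where "r0 = \<delta> / 2"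
      have r0: "0 < r0" "r0 < \<delta>" using \<delta> by (auto simp: r0_def)
      have "continuous_on (sphere a r0) \<Phi>"
        by (rule continuous_at_imp_continuous_on)
          (use d r0 DERIV_isCont in \<open>force simp: dist_commute\<close>)
      then have "bounded (\<Phi> ` sphere a r0)"
        by (intro compact_imp_bounded compact_continuous_image) auto
      then obtain B where "\<forall>z\<in>sphere a r0. norm (\<Phi> z) \<le> B"
        unfolding bounded_iff by auto
      then have B: "norm (\<Phi> z) \<le> B" if "dist a z = r0" for z
        using that by simp
      have "((\<lambda>z. norm (z - a) powi (-p)) \<longlongrightarrow> norm (a - a) powi (-p)) (at a)"
        using p0 by (intro tendsto_intros) auto
      then have "((\<lambda>z. B * norm (z - a) powi (-p)) \<longlongrightarrow> 0) (at a)"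
        using p0 by (intro tendsto_mult_right_zero) simp
      then have "\<forall>\<^sub>F z in at a. B * norm (z - a) powi (-p) < \<epsilon>"
        using order_tendstoD(2) \<epsilon> by blast
      moreover have "\<forall>\<^sub>F z in at a. z \<noteq> a \<and> dist z a < r0"
        using r0 unfolding eventually_at by auto
      ultimately show ?thesis
      proof eventually_elim
        case (elim z)
        define r where "r = norm (z - a)"
        define u where "u = sgn (z - a)"
        have r: "r > 0" "r < r0" and u: "norm u = 1" and zz: "z = a + of_real r * u"
          using elim polar unfolding r_def u_def by (auto simp: dist_norm)
        have "norm (\<Phi> z) \<le> norm (\<Phi> (a + of_real r0 * u)) + norm (\<Phi> (a + of_real r0 * u) - \<Phi> z)"
          by (metis norm_triangle_sub norm_minus_commute)
        also have "norm (\<Phi> (a + of_real r0 * u)) \<le> B"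
          by (rule B) (use r0 u in \<open>simp add: dist_norm norm_mult\<close>)
        also have "norm (\<Phi> (a + of_real r0 * u) - \<Phi> z)
            \<le> \<epsilon> / of_int p * (r0 powi p) - \<epsilon> / of_int p * (r powi p)"
          using rad[of r r0 u] r r0 u zz by auto
        also have "\<dots> \<le> \<epsilon> / (- of_int p) * (r powi p)"
        proof -
          have "\<epsilon> / of_int p * (r0 powi p) \<le> 0"
            using p0 \<epsilon> r0 by (intro mult_nonpos_nonneg) (auto simp: divide_simps)
          then show ?thesis by simp
        qed
        also have "\<dots> \<le> \<epsilon> / 1 * (r powi p)"
          using p0 \<epsilon> r by (intro mult_right_mono divide_left_mono) auto
        finally have "norm (\<Phi> z) \<le> B + \<epsilon> * r powi p" by simp
        then have "norm (\<Phi> z) * r powi (-p) \<le> (B + \<epsilon> * r powi p) * r powi (-p)"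
          using r by (intro mult_right_mono) auto
        also have "\<dots> = B * r powi (-p) + \<epsilon>"
          using r by (simp add: algebra_simps power_int_minus)
        also have "\<dots> \<le> 2 * \<epsilon>" using elim by (simp add: r_def)
        finally show ?case
          by (simp add: norm_divide norm_power_int r_def power_int_minus field_simps)
      qed
    qed
  qed
  show ?thesis
  proof (rule tendstoI)
    fix e :: real assume "e > 0"
    then show "\<forall>\<^sub>F z in at a. dist (\<Phi> z / (z - a) powi p) 0 < e"
      using key[of "e/3"] by (auto elim!: eventually_mono)
  qed
qed

text \<open>L'Hospital's rule for powers, obtained by subtracting \<open>(c/p) (z - a)\<^sup>p\<close>. The exponent \<open>0\<close> is excluded
  because a logarithm would appear.\<close>

lemma power_asymptotics_of_derivative:
  fixes \<Phi> \<Phi>' :: "complex \<Rightarrow> complex" and p :: int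
  assumes p: "p \<noteq> 0"
    and der: "\<forall>\<^sub>F z in at a. (\<Phi> has_field_derivative \<Phi>' z) (at z)"
    and lim: "((\<lambda>z. \<Phi>' z / (z - a) powi (p - 1)) \<longlongrightarrow> c) (at a)"
    and van: "p > 0 \<Longrightarrow> (\<Phi> \<longlongrightarrow> 0) (at a)"
  shows "((\<lambda>z. \<Phi> z / (z - a) powi p) \<longlongrightarrow> c / of_int p) (at a)"
proof -
  \<comment> \<open>the model with the asymptotics \<open>c\<close> of the derivative, removed to reach the case \<open>c = 0\<close>\<close>
  let ?\<Psi> = "\<lambda>z. \<Phi> z - c / of_int p * (z - a) powi p"
  have ne: "\<forall>\<^sub>F z in at a. z \<noteq> a"
    by (simp add: eventually_at_filter)
  have "((\<lambda>z. ?\<Psi> z / (z - a) powi p) \<longlongrightarrow> 0) (at a)"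
  proof (rule power_little_o_of_derivative[OF p, where \<Phi>' = "\<lambda>z. \<Phi>' z - c * (z - a) powi (p - 1)"])
    show "\<forall>\<^sub>F z in at a. (?\<Psi> has_field_derivative \<Phi>' z - c * (z - a) powi (p - 1)) (at z)"
      using der ne by eventually_elim (use p in \<open>auto intro!: derivative_eq_intros\<close>)
    have "((\<lambda>z. \<Phi>' z / (z - a) powi (p - 1) - c) \<longlongrightarrow> 0) (at a)"
      using lim by (simp add: LIM_zero)
    then show "((\<lambda>z. (\<Phi>' z - c * (z - a) powi (p - 1)) / (z - a) powi (p - 1)) \<longlongrightarrow> 0) (at a)"
      by (rule Lim_transform_eventually)
        (use ne in eventually_elim, simp add: diff_divide_distrib)
    assume "p > 0"
    then show "(?\<Psi> \<longlongrightarrow> 0) (at a)"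
      by (auto intro!: tendsto_eq_intros van)
  qed
  then have "((\<lambda>z. ?\<Psi> z / (z - a) powi p + c / of_int p) \<longlongrightarrow> 0 + c / of_int p) (at a)"
    by (intro tendsto_intros)
  then show ?thesis
    by (rule tendsto_transform_eq) (use ne in eventually_elim, simp_all add: diff_divide_distrib)
qed

text \<open>Here the velocity \<open>v\<close> of a zero or pole with exponent \<open>p\<close> is recovered. Near \<open>a\<close> the derivative \<open>\<Phi>'\<close> is
  asymptotic to \<open>- p v u (z - a)\<^sup>p\<^sup>-\<^sup>1\<close>, which integrates to \<open>- v u (z - a)\<^sup>p\<close>, that is to \<open>- v f\<close>. At a zero
  of \<open>f\<close> the constant of integration is not negligible and has to be removed beforehand.\<close>

lemma quotient_limit_at_divisor:
  fixes f L \<Phi> \<Phi>' :: "complex \<Rightarrow> complex" and p :: int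
  assumes p: "p \<noteq> 0"
    and f: "((\<lambda>z. f z / (z - a) powi p) \<longlongrightarrow> u) (at a)" and u: "u \<noteq> 0"
    and L: "((\<lambda>z. (z - a) * L z) \<longlongrightarrow> - (of_int p * v)) (at a)"
    and der: "\<forall>\<^sub>F z in at a. (\<Phi> has_field_derivative \<Phi>' z) (at z)"
    and fL: "\<forall>\<^sub>F z in at a. \<Phi>' z = f z * L z"
    and van: "p > 0 \<Longrightarrow> (\<Phi> \<longlongrightarrow> 0) (at a)"
  shows "((\<lambda>z. \<Phi> z / f z) \<longlongrightarrow> - v) (at a)"
proof -
  have ne: "\<forall>\<^sub>F z in at a. z \<noteq> a"
    by (simp add: eventually_at_filter)
  have "((\<lambda>z. f z / (z - a) powi p * ((z - a) * L z)) \<longlongrightarrow> u * - (of_int p * v)) (at a)"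
    by (intro tendsto_intros f L)
  then have "((\<lambda>z. \<Phi>' z / (z - a) powi (p - 1)) \<longlongrightarrow> u * - (of_int p * v)) (at a)"
    by (rule Lim_transform_eventually)
      (use ne fL in eventually_elim, simp add: power_int_diff)
  from power_asymptotics_of_derivative[OF p der this van]
  have "((\<lambda>z. \<Phi> z / (z - a) powi p) \<longlongrightarrow> - (u * v)) (at a)"
    using p by simp
  then have "((\<lambda>z. (\<Phi> z / (z - a) powi p) / (f z / (z - a) powi p)) \<longlongrightarrow> - (u * v) / u) (at a)"
    by (intro tendsto_intros f u)
  then show ?thesis
    by (rule tendsto_transform_eq) (use ne in eventually_elim, use u in simp_all)
qed

text \<open>The coordinate \<open>1/z\<close> reduces this to the rule for powers at \<open>0\<close>, with exponent \<open>- d\<close>. If \<open>f\<close> does not grow,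
  the constant of integration matters, so that \<open>\<Phi>\<close> itself has to vanish at infinity.\<close>

lemma quotient_limit_at_infinity:
  fixes f L \<Phi> \<Phi>' :: "complex \<Rightarrow> complex" and d :: int
  assumes f: "((\<lambda>z. f z / z powi d) \<longlongrightarrow> 1) at_infinity"
    and L: "((\<lambda>z. z * L z) \<longlongrightarrow> 0) at_infinity"
    and der: "\<forall>\<^sub>F z in at_infinity. (\<Phi> has_field_derivative \<Phi>' z) (at z)"
    and fL: "\<forall>\<^sub>F z in at_infinity. \<Phi>' z = f z * L z"
    and van: "d \<le> 0 \<Longrightarrow> (\<Phi> \<longlongrightarrow> 0) at_infinity"
  shows "((\<lambda>z. \<Phi> z / f z) \<longlongrightarrow> 0) at_infinity"
proof -
  have nz: "\<forall>\<^sub>F z in at_infinity. z \<noteq> (0::complex)"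
    by (simp add: eventually_not_equal_at_infinity)
  have lim: "((\<lambda>z. \<Phi> z / z powi d) \<longlongrightarrow> 0) at_infinity"
  proof (cases "d = 0")
    case True
    then show ?thesis using van by simp
  next
    case False
    have ne: "\<forall>\<^sub>F w in at 0. w \<noteq> (0::complex)"
      by (simp add: eventually_at_filter)
    have "((\<lambda>w. \<Phi> (inverse w) / (w - 0) powi (- d)) \<longlongrightarrow> 0) (at 0)"
    proof (rule power_little_o_of_derivative[where \<Phi>' = "\<lambda>w. \<Phi>' (inverse w) * - (inverse w ^ 2)"])
      have "\<forall>\<^sub>F w in at 0. (\<Phi> has_field_derivative \<Phi>' (inverse w)) (at (inverse w))"
        using der by (simp add: eventually_at_infinity_inverse)
      then show "\<forall>\<^sub>F w in at 0. ((\<lambda>w. \<Phi> (inverse w)) has_field_derivative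
          \<Phi>' (inverse w) * - (inverse w ^ 2)) (at w)"
        using ne
      proof eventually_elim
        case (elim w)
        then show ?case
          by (intro DERIV_chain2[where f = \<Phi> and g = inverse])
            (auto intro!: derivative_eq_intros simp: power2_eq_square)
      qed
      have "((\<lambda>z. - ((f z / z powi d) * (z * L z))) \<longlongrightarrow> - (1 * 0)) at_infinity"
        by (intro tendsto_intros f L)
      then have "((\<lambda>w. - ((f (inverse w) / inverse w powi d) * (inverse w * L (inverse w)))) \<longlongrightarrow> 0) (at 0)"
        by (simp add: lim_at_infinity_0 o_def)
      moreover have "\<forall>\<^sub>F w in at 0. \<Phi>' (inverse w) = f (inverse w) * L (inverse w)"
        using fL by (simp add: eventually_at_infinity_inverse)
      ultimately show "((\<lambda>w. \<Phi>' (inverse w) * - (inverse w ^ 2) / (w - 0) powi (- d - 1)) \<longlongrightarrow> 0) (at 0)"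
      proof (elim tendsto_transform_eq)
        assume "\<forall>\<^sub>F w in at 0. \<Phi>' (inverse w) = f (inverse w) * L (inverse w)"
        then show "\<forall>\<^sub>F w in at 0. - (f (inverse w) / inverse w powi d * (inverse w * L (inverse w)))
            = \<Phi>' (inverse w) * - (inverse w ^ 2) / (w - 0) powi (- d - 1)"
          using ne by eventually_elim
            (simp add: power_int_diff power_int_minus power_int_inverse power2_eq_square field_simps)
      qed simp
      show "((\<lambda>w. \<Phi> (inverse w)) \<longlongrightarrow> 0) (at 0)" if "0 < - d"
        using van that by (simp add: lim_at_infinity_0 o_def)
    qed (use False in simp)
    then show ?thesis
      by (simp add: lim_at_infinity_0 o_def power_int_minus power_int_inverse divide_inverse)
  qed
  have "((\<lambda>z. (\<Phi> z / z powi d) / (f z / z powi d)) \<longlongrightarrow> 0 / 1) at_infinity"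
    by (intro tendsto_intros f lim) simp
  then show ?thesis
    by (rule tendsto_transform_eq) (use nz in eventually_elim, simp_all)
qed

section \<open>Products of integer powers with moving centres\<close>

text \<open>Zeros (\<open>e i > 0\<close>) and poles (\<open>e i < 0\<close>) are factors of the same kind.\<close>

definition factored :: "'i set \<Rightarrow> ('i \<Rightarrow> int) \<Rightarrow> ('i \<Rightarrow> complex) \<Rightarrow> complex \<Rightarrow> complex" where
  "factored I e c z = (\<Prod>i\<in>I. (z - c i) powi e i)"

text \<open>The time derivative of \<open>factored I e c z\<close> when \<open>c i\<close> moves with velocity \<open>v i\<close>. The shorter expression
  \<open>factored I e c z * log_dot I e c v z\<close> would take a wrong value at a zero of order one, where
  the division by \<open>0\<close> in \<open>log_dot\<close> yields \<open>0\<close>.\<close>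

definition factored_dot ::
    "'i set \<Rightarrow> ('i \<Rightarrow> int) \<Rightarrow> ('i \<Rightarrow> complex) \<Rightarrow> ('i \<Rightarrow> complex) \<Rightarrow> complex \<Rightarrow> complex" where
  "factored_dot I e c v z =
     - (\<Sum>i\<in>I. of_int (e i) * v i * (z - c i) powi (e i - 1) * factored (I - {i}) e c z)"

text \<open>The logarithmic time derivative of \<open>factored I e c z\<close>.\<close>

definition log_dot ::
    "'i set \<Rightarrow> ('i \<Rightarrow> int) \<Rightarrow> ('i \<Rightarrow> complex) \<Rightarrow> ('i \<Rightarrow> complex) \<Rightarrow> complex \<Rightarrow> complex" where
  "log_dot I e c v z = - (\<Sum>i\<in>I. of_int (e i) * v i / (z - c i))"

lemma factored_remove:
  assumes "finite I" "i \<in> I"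
  shows "factored I e c z = (z - c i) powi e i * factored (I - {i}) e c z"
  unfolding factored_def using assms by (simp add: prod.remove)

lemma factored_nonzero:
  assumes "finite I" "\<And>i. i \<in> I \<Longrightarrow> z \<noteq> c i"
  shows "factored I e c z \<noteq> 0"
  using assms unfolding factored_def by auto

lemma factored_dot_eq:
  assumes "finite I" "\<And>i. i \<in> I \<Longrightarrow> z \<noteq> c i"
  shows "factored_dot I e c v z = factored I e c z * log_dot I e c v z"
proof -
  have "(z - c i) powi (e i - 1) * factored (I - {i}) e c z = factored I e c z / (z - c i)" if "i \<in> I" for i
    using assms that by (simp add: factored_remove[OF assms(1) that] power_int_diff)
  then show ?thesis
    unfolding factored_dot_def log_dot_def
    by (simp add: sum_distrib_left mult_ac)
qed

lemma factored_has_derivative_in_divisor: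
  fixes c :: "'i \<Rightarrow> real \<Rightarrow> complex"
  assumes der: "\<And>i. i \<in> I \<Longrightarrow> (c i has_vector_derivative v i) (at s within U)"
    and avoid: "\<And>i. i \<in> I \<Longrightarrow> e i < 0 \<Longrightarrow> z \<noteq> c i s"
  shows "((\<lambda>s. factored I e (\<lambda>i. c i s) z) has_vector_derivative
           factored_dot I e (\<lambda>i. c i s) v z) (at s within U)"
proof -
  have 1: "((\<lambda>s. (z - c i s) powi e i) has_derivative
        (\<lambda>h. h *\<^sub>R (- (of_int (e i) * v i * (z - c i s) powi (e i - 1))))) (at s within U)" if i: "i \<in> I" for i
  proof -
    have "((\<lambda>x. (z - x) powi e i) has_field_derivative - (of_int (e i) * (z - c i s) powi (e i - 1)))
        (at (c i s) within c i ` U)"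
      using avoid[OF i] by (auto intro!: derivative_eq_intros)
    from field_vector_diff_chain_within[OF der[OF i] this] show ?thesis
      by (simp add: o_def has_vector_derivative_def mult_ac)
  qed
  have "((\<lambda>s. \<Prod>i\<in>I. (z - c i s) powi e i) has_derivative
      (\<lambda>h. \<Sum>i\<in>I. h *\<^sub>R (- (of_int (e i) * v i * (z - c i s) powi (e i - 1)))
          * (\<Prod>j\<in>I - {i}. (z - c j s) powi e j))) (at s within U)"
    by (rule has_derivative_prod) (use 1 in auto)
  then show ?thesis
    unfolding has_vector_derivative_def factored_def factored_dot_def
    by (simp add: scaleR_sum_right sum_negf)
qed

lemma continuous_on_factored:
  assumes "\<And>i. i \<in> I \<Longrightarrow> continuous_on X (c i)" "continuous_on X z"
    and "\<And>i x. i \<in> I \<Longrightarrow> e i < 0 \<Longrightarrow> x \<in> X \<Longrightarrow> z x \<noteq> c i x"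
  shows "continuous_on X (\<lambda>x. factored I e (\<lambda>i. c i x) (z x))"
  unfolding factored_def
proof (rule continuous_on_prod)
  fix i assume i: "i \<in> I"
  show "continuous_on X (\<lambda>x. (z x - c i x) powi e i)"
    unfolding continuous_on_def
  proof
    fix x assume x: "x \<in> X"
    show "((\<lambda>x. (z x - c i x) powi e i) \<longlongrightarrow> (z x - c i x) powi e i) (at x within X)"
      using assms(1)[OF i] assms(2) x assms(3)[OF i _ x]
      by (intro tendsto_power_int' tendsto_diff) (auto simp: continuous_on_def not_le[symmetric])
  qed
qed

lemma continuous_on_factored_dot:
  assumes e: "\<And>i. i \<in> I \<Longrightarrow> e i \<noteq> 0"
    and cont: "\<And>i. i \<in> I \<Longrightarrow> continuous_on X (c i)" "\<And>i. i \<in> I \<Longrightarrow> continuous_on X (v i)"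
      "continuous_on X z"
    and avoid: "\<And>i x. i \<in> I \<Longrightarrow> e i < 0 \<Longrightarrow> x \<in> X \<Longrightarrow> z x \<noteq> c i x"
  shows "continuous_on X (\<lambda>x. factored_dot I e (\<lambda>i. c i x) (\<lambda>i. v i x) (z x))"
proof -
  have "continuous_on X (\<lambda>x. (z x - c i x) powi (e i - 1))" if i: "i \<in> I" for i
    using continuous_on_factored[of "{i}" X c z "\<lambda>i. e i - 1"] cont avoid[OF i] e[OF i] i
    by (force simp: factored_def)
  moreover have "continuous_on X (\<lambda>x. factored (I - {i}) e (\<lambda>i. c i x) (z x))" for i
    using cont avoid by (intro continuous_on_factored) auto
  ultimately show ?thesis
    unfolding factored_dot_def
    by (intro continuous_on_minus continuous_on_sum continuous_on_mult continuous_on_const cont) auto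
qed

lemma factored_dot_holomorphic:
  assumes e: "\<And>i. i \<in> I \<Longrightarrow> e i \<noteq> 0"
    and avoid: "\<And>i. i \<in> I \<Longrightarrow> e i < 0 \<Longrightarrow> c i \<notin> S"
  shows "factored_dot I e c v holomorphic_on S"
proof -
  have *: "e i - 1 \<ge> 0 \<or> (\<forall>z\<in>S. z - c i \<noteq> 0)" "e i \<ge> 0 \<or> (\<forall>z\<in>S. z - c i \<noteq> 0)" if "i \<in> I" for i
    using e[OF that] avoid[OF that] by (cases "e i < 0"; auto)+
  have "(\<lambda>z. - (\<Sum>i\<in>I. of_int (e i) * v i * (z - c i) powi (e i - 1) * factored (I - {i}) e c z))
      holomorphic_on S"
    unfolding factored_def by (intro holomorphic_intros *) auto
  then show ?thesis by (simp add: factored_dot_def[abs_def])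
qed

lemma factored_asymptotics_at_infinity:
  assumes "finite I"
  shows "((\<lambda>z. factored I e c z / z powi (\<Sum>i\<in>I. e i)) \<longlongrightarrow> 1) at_infinity"
proof -
  have nz: "\<forall>\<^sub>F z in at_infinity. z \<noteq> (0::complex)"
    by (simp add: eventually_not_equal_at_infinity)
  have "((\<lambda>z. \<Prod>i\<in>I. (1 - c i / z) powi e i) \<longlongrightarrow> (\<Prod>i\<in>I. (1 - 0) powi e i)) at_infinity"
    by (intro tendsto_intros tendsto_divide_0[OF tendsto_const] filterlim_ident) auto
  then show ?thesis
  proof (rule tendsto_transform_eq)
    show "\<forall>\<^sub>F z in at_infinity. (\<Prod>i\<in>I. (1 - c i / z) powi e i) = factored I e c z / z powi (\<Sum>i\<in>I. e i)"
      using nz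
    proof eventually_elim
      case (elim z)
      have "(1 - c i / z) powi e i = (z - c i) powi e i / z powi e i" for i
        using elim by (simp flip: power_int_divide_distrib add: diff_divide_distrib)
      moreover have "z powi (\<Sum>i\<in>I. e i) = (\<Prod>i\<in>I. z powi e i)"
        using \<open>finite I\<close> by (induction I) (use elim in \<open>auto simp: power_int_add\<close>)
      ultimately show ?case by (simp add: factored_def prod_dividef)
    qed
  qed simp
qed

lemma log_dot_at_infinity:
  "((\<lambda>z. z * log_dot I e c v z) \<longlongrightarrow> - (\<Sum>i\<in>I. of_int (e i) * v i)) at_infinity"
proof -
  have nz: "\<forall>\<^sub>F z in at_infinity. z \<noteq> (0::complex)"
    by (simp add: eventually_not_equal_at_infinity)
  have "((\<lambda>z. - (\<Sum>i\<in>I. of_int (e i) * v i / (1 - c i / z))) \<longlongrightarrow> 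
      - (\<Sum>i\<in>I. of_int (e i) * v i / (1 - 0))) at_infinity"
    by (intro tendsto_intros tendsto_divide_0[OF tendsto_const] filterlim_ident) auto
  then show ?thesis
  proof (rule tendsto_transform_eq)
    show "\<forall>\<^sub>F z in at_infinity. - (\<Sum>i\<in>I. of_int (e i) * v i / (1 - c i / z)) = z * log_dot I e c v z"
      using nz
    proof eventually_elim
      case (elim z)
      have "of_int (e i) * v i / (1 - c i / z) = z * (of_int (e i) * v i / (z - c i))" for i
        using elim by (simp add: field_simps)
      then show ?case by (simp add: log_dot_def sum_distrib_left)
    qed
  qed simp
qed

lemma factored_asymptotics_at_divisor:
  assumes "finite I" "i \<in> I" "inj_on c I"
  shows "((\<lambda>z. factored I e c z / (z - c i) powi e i) \<longlongrightarrow> factored (I - {i}) e c (c i)) (at (c i))"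
proof (rule tendsto_transform_eq)
  have "c i - c j \<noteq> 0" if "j \<in> I - {i}" for j
    using inj_onD[OF assms(3), of i j] assms(2) that by auto
  then show "(factored (I - {i}) e c \<longlongrightarrow> factored (I - {i}) e c (c i)) (at (c i))"
    unfolding factored_def by (intro tendsto_intros) auto
  have "\<forall>\<^sub>F z in at (c i). z \<noteq> c i"
    by (simp add: eventually_at_filter)
  then show "\<forall>\<^sub>F z in at (c i). factored (I - {i}) e c z = factored I e c z / (z - c i) powi e i"
    by eventually_elim (simp add: factored_remove[OF assms(1,2)])
qed simp

lemma log_dot_at_divisor:
  assumes "finite I" "i \<in> I" "inj_on c I"
  shows "((\<lambda>z. (z - c i) * log_dot I e c v z) \<longlongrightarrow> - (of_int (e i) * v i)) (at (c i))"
proof (rule tendsto_transform_eq)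
  have "c i - c j \<noteq> 0" if "j \<in> I - {i}" for j
    using inj_onD[OF assms(3), of i j] assms(2) that by auto
  then show "((\<lambda>z. - (of_int (e i) * v i + (z - c i) * (\<Sum>j\<in>I - {i}. of_int (e j) * v j / (z - c j))))
      \<longlongrightarrow> - (of_int (e i) * v i + (c i - c i) * (\<Sum>j\<in>I - {i}. of_int (e j) * v j / (c i - c j)))) (at (c i))"
    by (intro tendsto_intros) auto
  have "\<forall>\<^sub>F z in at (c i). z \<noteq> c i"
    by (simp add: eventually_at_filter)
  then show "\<forall>\<^sub>F z in at (c i). - (of_int (e i) * v i + (z - c i) * (\<Sum>j\<in>I - {i}. of_int (e j) * v j / (z - c j)))
      = (z - c i) * log_dot I e c v z"
    by eventually_elim (simp add: log_dot_def sum.remove[OF assms(1,2)] field_simps)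
qed simp

section \<open>Representation by the derivative on a circle around infinity\<close>

text \<open>The function \<open>w \<mapsto> G (z\<^sub>0 / w)\<close>, extended by \<open>0\<close> at \<open>w = 0\<close>, is holomorphic in the unit disc, so its mean
  over the unit circle is \<open>0\<close>. Integrating \<open>\<theta>\<close> times the derivative of \<open>G \<circ> \<gamma>\<close> by parts therefore leaves just the
  boundary term \<open>G z\<^sub>0\<close>. Unlike an integral from infinity along a ray, this integral runs over a compact
  curve and can be differentiated with respect to a parameter without estimates near infinity.\<close>

lemma mean_value_representation_at_infinity:
  fixes G G' :: "complex \<Rightarrow> complex"
  assumes z0: "z\<^sub>0 \<noteq> 0"
    and der: "\<And>z. norm z \<ge> norm z\<^sub>0 \<Longrightarrow> (G has_field_derivative G' z) (at z)"
    and lim: "(G \<longlongrightarrow> 0) at_infinity"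
  defines "\<gamma> \<equiv> \<lambda>\<theta>::real. z\<^sub>0 * exp (- (2 * of_real pi * \<i> * of_real \<theta>))"
  shows "((\<lambda>\<theta>. - (2 * of_real pi * \<i> * of_real \<theta>) * \<gamma> \<theta> * G' (\<gamma> \<theta>)) has_integral G z\<^sub>0) {0..1}"
proof -
  define h where "h = (\<lambda>w. if w = 0 then 0 else G (z\<^sub>0 * inverse w))"
  have big: "norm (z\<^sub>0 * inverse w) \<ge> norm z\<^sub>0" if "w \<noteq> 0" "norm w \<le> 1" for w
    using that mult_left_mono[of 1 "inverse (norm w)" "norm z\<^sub>0"]
    by (simp add: norm_mult norm_inverse one_le_inverse)
  have diff: "((\<lambda>w. G (z\<^sub>0 * inverse w)) has_field_derivative
        G' (z\<^sub>0 * inverse w) * - (z\<^sub>0 * inverse w ^ 2)) (at w)"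
    if "w \<noteq> 0" "norm w \<le> 1" for w
    by (rule DERIV_chain2[where f = G and g = "\<lambda>w. z\<^sub>0 * inverse w"])
      (use that der[OF big[OF that]] in \<open>auto intro!: derivative_eq_intros simp: power2_eq_square\<close>)
  have lim0: "((\<lambda>w. G (z\<^sub>0 * inverse w)) \<longlongrightarrow> 0) (at 0)"
  proof (rule filterlim_compose[OF lim])
    show "filterlim (\<lambda>w. z\<^sub>0 * inverse w) at_infinity (at 0)"
      using z0 by (intro tendsto_mult_filterlim_at_infinity[OF tendsto_const])
        (auto intro: filterlim_inverse_at_infinity)
  qed
  have hol: "h holomorphic_on ball 0 1"
    unfolding h_def
  proof (rule removable_singularity[OF _ open_ball lim0])
    show "(\<lambda>w. G (z\<^sub>0 * inverse w)) holomorphic_on ball 0 1 - {0}"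
      unfolding holomorphic_on_def field_differentiable_def
      using diff by (fastforce intro: has_field_derivative_at_within)
  qed
  have cont: "continuous_on (cball 0 1) h"
  proof (rule continuous_at_imp_continuous_on, rule ballI)
    fix w :: complex assume w: "w \<in> cball 0 1"
    show "isCont h w"
    proof (cases "w = 0")
      case True
      have "(h \<longlongrightarrow> 0) (at 0)"
        by (rule tendsto_transform_eq[OF lim0]) (auto simp: h_def eventually_at_filter)
      then show ?thesis using True by (simp add: isCont_def h_def)
    next
      case False
      have "isCont (\<lambda>w. G (z\<^sub>0 * inverse w)) w"
        using DERIV_isCont[OF diff] False w by simp
      moreover have "\<forall>\<^sub>F x in nhds w. h x = G (z\<^sub>0 * inverse x)"
        using t1_space_nhds[OF False] by eventually_elim (simp add: h_def)
      ultimately show ?thesis by (simp cong: isCont_cong)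
    qed
  qed
  have "((\<lambda>u. h u / (u - 0)) has_contour_integral (2 * of_real pi * \<i> * h 0)) (circlepath 0 1)"
    by (rule Cauchy_integral_circlepath[OF cont hol]) simp
  then have "((\<lambda>\<theta>. h (circlepath 0 1 \<theta>) / circlepath 0 1 \<theta> * (2 * pi * \<i> * exp (2 * of_real pi * \<i> * \<theta>)))
      has_integral 0) {0..1}"
    by (simp add: has_contour_integral vector_derivative_circlepath h_def)
  then have "((\<lambda>\<theta>. inverse (2 * of_real pi * \<i>) *
      (h (circlepath 0 1 \<theta>) / circlepath 0 1 \<theta> * (2 * pi * \<i> * exp (2 * of_real pi * \<i> * \<theta>))))
      has_integral inverse (2 * of_real pi * \<i>) * 0) {0..1}"
    by (rule has_integral_mult_right)
  then have mean: "((\<lambda>\<theta>. G (\<gamma> \<theta>)) has_integral 0) {0..1}"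
    by (rule has_integral_eq_rhs[OF has_integral_eq, rotated])
      (simp_all add: h_def circlepath \<gamma>_def exp_minus field_simps)
  have D\<gamma>: "(\<gamma> has_vector_derivative - (2 * of_real pi * \<i>) * \<gamma> \<theta>) (at \<theta> within {0..1})" for \<theta>
  proof -
    have "((\<lambda>x. z\<^sub>0 * exp (- (2 * of_real pi * \<i> * x))) has_field_derivative
        - (2 * of_real pi * \<i>) * \<gamma> \<theta>) (at (of_real \<theta>))"
      unfolding \<gamma>_def by (auto intro!: derivative_eq_intros)
    then show ?thesis
      unfolding \<gamma>_def by (rule has_vector_derivative_real_field)
  qed
  have n\<gamma>: "norm (\<gamma> \<theta>) = norm z\<^sub>0" for \<theta>
    by (simp add: \<gamma>_def norm_mult norm_exp_eq_Re)
  have DG: "((\<lambda>\<theta>. G (\<gamma> \<theta>)) has_vector_derivative - (2 * of_real pi * \<i>) * \<gamma> \<theta> * G' (\<gamma> \<theta>)) (at \<theta> within {0..1})" for \<theta>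
    using field_vector_diff_chain_within[OF D\<gamma>, of G "G' (\<gamma> \<theta>)"] der[of "\<gamma> \<theta>"] n\<gamma>[of \<theta>]
    by (simp add: o_def has_field_derivative_at_within)
  have "((\<lambda>\<theta>. of_real \<theta> * (- (2 * of_real pi * \<i>) * \<gamma> \<theta> * G' (\<gamma> \<theta>)) + 1 * G (\<gamma> \<theta>))
      has_integral of_real 1 * G (\<gamma> 1) - of_real 0 * G (\<gamma> 0)) {0..1}"
    by (rule fundamental_theorem_of_calculus)
      (auto intro!: has_vector_derivative_mult DG has_vector_derivative_real_field derivative_eq_intros)
  from has_integral_diff[OF this mean]
  have "((\<lambda>\<theta>. of_real \<theta> * (- (2 * of_real pi * \<i>) * \<gamma> \<theta> * G' (\<gamma> \<theta>))) has_integral G (\<gamma> 1)) {0..1}"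
    by simp
  moreover have "\<gamma> 1 = z\<^sub>0"
    by (simp add: \<gamma>_def exp_minus)
  ultimately show ?thesis
    by (simp add: algebra_simps)
qed

section \<open>Principal parts and the global partial fraction argument\<close>

text \<open>Riemann's theorem removes the singularities, and the extension is constant by Liouville's theorem. What is
  used below is the resulting vanishing of the limits \<open>l x\<close>.\<close>

lemma Liouville_removable:
  fixes g :: "complex \<Rightarrow> complex"
  assumes fin: "finite S" and hol: "g holomorphic_on - S"
    and lim: "\<And>x. x \<in> S \<Longrightarrow> (g \<longlongrightarrow> l x) (at x)"
    and inf: "(g \<longlongrightarrow> 0) at_infinity"
  shows "x \<in> S \<Longrightarrow> l x = 0"
proof -
  define h where "h = (\<lambda>z. if z \<in> S then l z else g z)"
  have near: "\<forall>\<^sub>F z in at x. g z = h z" for x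
    using islimpt_finite[OF fin, of x] unfolding islimpt_iff_eventually
    by (auto elim!: eventually_mono simp: h_def)
  have "h holomorphic_on UNIV"
  proof (rule no_isolated_singularity'[OF _ _ _ fin])
    show "(h \<longlongrightarrow> h z) (at z within UNIV)" if "z \<in> S" for z
      using Lim_transform_eventually[OF lim[OF that] near] that by (simp add: h_def)
    have "g holomorphic_on UNIV - S"
      using hol by (simp add: Compl_eq_Diff_UNIV)
    then show "h holomorphic_on UNIV - S"
      by (rule holomorphic_transform) (simp add: h_def)
  qed simp
  moreover have "(h \<longlongrightarrow> 0) at_infinity"
  proof (rule Lim_transform_eventually[OF inf])
    obtain B where "\<And>x. x \<in> S \<Longrightarrow> norm x \<le> B"
      using finite_imp_bounded[OF fin] bounded_iff by blast
    then have "z \<notin> S" if "norm z \<ge> B + 1" for z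
      using that by force
    then have "\<forall>\<^sub>F z in at_infinity. z \<notin> S"
      unfolding eventually_at_infinity by blast
    then show "\<forall>\<^sub>F z in at_infinity. g z = h z"
      by eventually_elim (simp add: h_def)
  qed
  ultimately have "h x = 0" by (rule Liouville_weak_0)
  then show "l x = 0" if "x \<in> S" using that by (simp add: h_def)
qed

lemma higher_deriv_inverse_linear:
  fixes z x :: complex
  assumes "z \<noteq> x"
  shows "(deriv ^^ n) (\<lambda>w. 1 / (w - x)) z = (-1) ^ n * fact n * (z - x) powi (- int (Suc n))"
  using assms
proof (induction n arbitrary: z)
  case 0
  then show ?case by (simp add: power_int_minus divide_inverse)
next
  case (Suc n)
  have "\<forall>\<^sub>F w in nhds z. (deriv ^^ n) (\<lambda>w. 1 / (w - x)) w = (-1) ^ n * fact n * (w - x) powi (- int (Suc n))"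
    using t1_space_nhds[OF Suc.prems] by eventually_elim (rule Suc.IH)
  then have "deriv ((deriv ^^ n) (\<lambda>w. 1 / (w - x))) z
      = deriv (\<lambda>w. (-1) ^ n * fact n * (w - x) powi (- int (Suc n))) z"
    by (rule deriv_cong_ev) simp
  also have "\<dots> = (-1) ^ n * fact n * (of_int (- int (Suc n)) * (z - x) powi (- int (Suc n) - 1) * 1)"
    by (rule DERIV_imp_deriv, rule DERIV_cmult, rule DERIV_power_int)
      (use Suc.prems in \<open>auto intro!: derivative_eq_intros\<close>)
  also have "- int (Suc n) - 1 = - int (Suc (Suc n))" by simp
  finally show ?case by (simp del: of_nat_Suc add: algebra_simps)
qed

text \<open>The principal part at \<open>a\<close> of \<open>h z / (z - a)\<^sup>\<mu>\<close>, for \<open>h\<close> analytic at \<open>a\<close>.\<close>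

definition principal_part :: "(complex \<Rightarrow> complex) \<Rightarrow> complex \<Rightarrow> nat \<Rightarrow> complex \<Rightarrow> complex" where
  "principal_part h a \<mu> z = (\<Sum>j<\<mu>. (deriv ^^ j) h a / fact j / (z - a) ^ (\<mu> - j))"

text \<open>By Leibniz' rule: the derivatives of \<open>1/(z - x)\<close> at \<open>a\<close> produce exactly the powers of \<open>1/(x - a)\<close> in the
  principal part. This is how the derivatives of the functions \<open>G_fun\<close> and \<open>I_fun\<close> enter.\<close>

lemma principal_part_eq_higher_deriv:
  assumes h: "h analytic_on {a}" and x: "x \<noteq> a" and \<mu>: "\<mu> \<ge> 1"
  shows "(deriv ^^ (\<mu> - 1)) (\<lambda>z. h z / (z - x)) a / fact (\<mu> - 1) = - principal_part h a \<mu> x"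
proof -
  obtain k where k: "\<mu> = Suc k" using \<mu> by (cases \<mu>) auto
  have "(deriv ^^ k) (\<lambda>z. h z * (1 / (z - x))) a =
      (\<Sum>j = 0..k. of_nat (k choose j) * (deriv ^^ j) h a * (deriv ^^ (k - j)) (\<lambda>z. 1 / (z - x)) a)"
    by (rule higher_deriv_mult_at) (use h x in \<open>auto intro!: analytic_intros\<close>)
  also have "\<dots> = (\<Sum>j = 0..k. fact k * - ((deriv ^^ j) h a / fact j / (x - a) ^ (\<mu> - j)))"
  proof (rule sum.cong)
    fix j assume j: "j \<in> {0..k}"
    have "(a - x) ^ (k - j + 1) = (-1) ^ (k - j + 1) * (x - a) ^ (k - j + 1)"
      by (metis minus_diff_eq power_minus)
    then have "(-1) ^ (k - j) * fact (k - j) * (a - x) powi (- int (Suc (k - j)))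
        = - (fact (k - j) / (x - a) ^ (k - j + 1))"
      unfolding power_int_minus power_int_of_nat Suc_eq_plus1 by (simp add: divide_inverse)
    moreover have "of_nat (k choose j) = (fact k / (fact j * fact (k - j)) :: complex)"
      using j by (simp add: binomial_fact)
    moreover have "\<mu> - j = k - j + 1" using j k by auto
    ultimately show "of_nat (k choose j) * (deriv ^^ j) h a * (deriv ^^ (k - j)) (\<lambda>z. 1 / (z - x)) a =
        fact k * - ((deriv ^^ j) h a / fact j / (x - a) ^ (\<mu> - j))"
      using x by (simp add: higher_deriv_inverse_linear)
  qed simp
  also have "\<dots> = fact k * - principal_part h a \<mu> x"
    unfolding principal_part_def k
    by (simp only: sum_distrib_left sum_negf atLeast0AtMost lessThan_Suc_atMost mult_minus_right)
  finally show ?thesis by (simp add: k)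
qed

text \<open>Induction on \<open>\<mu>\<close>: the derivative of the remainder of \<open>h\<close> is the remainder of \<open>deriv h\<close> of one order less,
  and the rule for powers integrates its asymptotics.\<close>

lemma taylor_remainder_limit:
  fixes h :: "complex \<Rightarrow> complex"
  assumes "h analytic_on {a}"
  shows "((\<lambda>z. (h z - (\<Sum>j<\<mu>. (deriv ^^ j) h a / fact j * (z - a) ^ j)) / (z - a) ^ \<mu>)
           \<longlongrightarrow> (deriv ^^ \<mu>) h a / fact \<mu>) (at a)"
  using assms
proof (induction \<mu> arbitrary: h)
  case 0
  then show ?case
    using analytic_at_imp_isCont[of h a] by (simp add: isCont_def)
next
  case (Suc \<mu>)
  have swap: "(deriv ^^ j) (deriv h) = (deriv ^^ Suc j) h" for j
    by (simp add: funpow_swap1)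
  have an: "\<forall>\<^sub>F z in at a. (h has_field_derivative deriv h z) (at z)"
  proof -
    obtain S where "open S" "a \<in> S" "h holomorphic_on S"
      using Suc.prems analytic_at by blast
    note S = this
    have "\<forall>\<^sub>F z in nhds a. (h has_field_derivative deriv h z) (at z)"
      using eventually_nhds_in_open[OF S(1,2)]
      by eventually_elim (rule holomorphic_derivI[OF S(3,1)])
    then show ?thesis by (simp add: eventually_nhds_conv_at)
  qed
  let ?h = "\<lambda>z. h z - (\<Sum>j<Suc \<mu>. (deriv ^^ j) h a / fact j * (z - a) ^ j)"
  let ?h' = "\<lambda>z. deriv h z - (\<Sum>j<\<mu>. (deriv ^^ j) (deriv h) a / fact j * (z - a) ^ j)"
  have "((\<lambda>z. ?h z / (z - a) powi int (Suc \<mu>)) \<longlongrightarrow> (deriv ^^ \<mu>) (deriv h) a / fact \<mu> / of_int (int (Suc \<mu>))) (at a)"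
  proof (rule power_asymptotics_of_derivative[where \<Phi>' = ?h'])
    show "\<forall>\<^sub>F z in at a. (?h has_field_derivative ?h' z) (at z)"
      using an
    proof eventually_elim
      case (elim z)
      have "(?h has_field_derivative deriv h z -
          (\<Sum>j<Suc \<mu>. (deriv ^^ j) h a / fact j * (of_nat j * (z - a) ^ (j - 1)))) (at z)"
      proof (intro DERIV_diff elim DERIV_sum DERIV_cmult)
        show "((\<lambda>z. (z - a) ^ j) has_field_derivative of_nat j * (z - a) ^ (j - 1)) (at z)" for j
          by (auto intro!: derivative_eq_intros)
      qed
      moreover have "(\<Sum>j<Suc \<mu>. (deriv ^^ j) h a / fact j * (of_nat j * (z - a) ^ (j - 1)))
          = (\<Sum>j<\<mu>. (deriv ^^ j) (deriv h) a / fact j * (z - a) ^ j)"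
      proof -
        have "(deriv ^^ Suc j) h a / fact (Suc j) * (of_nat (Suc j) * (z - a) ^ (Suc j - 1))
            = (deriv ^^ j) (deriv h) a / fact j * (z - a) ^ j" for j
          unfolding swap fact_Suc by (simp del: of_nat_Suc funpow.simps)
        then show ?thesis
          by (simp only: sum.lessThan_Suc_shift) simp
      qed
      ultimately show ?case by simp
    qed
    show "((\<lambda>z. ?h' z / (z - a) powi (int (Suc \<mu>) - 1)) \<longlongrightarrow> (deriv ^^ \<mu>) (deriv h) a / fact \<mu>) (at a)"
      using Suc.IH[of "deriv h"] analytic_deriv[OF Suc.prems] by simp
    have "(h \<longlongrightarrow> h a) (at a)"
      using analytic_at_imp_isCont[OF Suc.prems] by (simp add: isCont_def)
    then have "(?h \<longlongrightarrow> h a - (\<Sum>j<Suc \<mu>. (deriv ^^ j) h a / fact j * (a - a) ^ j)) (at a)"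
      by (intro tendsto_intros)
    then show "(?h \<longlongrightarrow> 0) (at a)"
      by (simp add: sum.lessThan_Suc_shift del: sum.lessThan_Suc)
  qed simp
  moreover have "(deriv ^^ \<mu>) (deriv h) a / fact \<mu> / of_int (int (Suc \<mu>)) = (deriv ^^ Suc \<mu>) h a / fact (Suc \<mu>)"
    unfolding swap fact_Suc by (simp add: mult.commute del: of_nat_Suc funpow.simps)
  ultimately show ?case
    by (simp only: power_int_of_nat)
qed

text \<open>With this function \<open>1 / factored I e c z = cofactor I e c k z / (z - c k)\<^sup>e\<close> for \<open>e = e k\<close>, so it
  governs the principal part at a zero \<open>c k\<close>. For a critical point it is the function \<open>H_fun\<close>.\<close>

definition cofactor :: "'i set \<Rightarrow> ('i \<Rightarrow> int) \<Rightarrow> ('i \<Rightarrow> complex) \<Rightarrow> 'i \<Rightarrow> complex \<Rightarrow> complex" where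
  "cofactor I e c k = factored (I - {k}) (\<lambda>i. - e i) c"

lemma cofactor_eq: "cofactor I e c k z = inverse (factored (I - {k}) e c z)"
  unfolding cofactor_def factored_def by (simp add: power_int_minus prod_inversef[symmetric] o_def)

lemma cofactor_analytic:
  assumes "inj_on c I" "k \<in> I"
  shows "cofactor I e c k analytic_on {c k}"
proof -
  have "c k \<noteq> c i" if "i \<in> I - {k}" for i
    using inj_onD[OF assms(1), of k i] assms(2) that by auto
  then have "(\<lambda>z. (z - c i) powi n) analytic_on {c k}" if "i \<in> I - {k}" for i n
    using that by (intro analytic_intros) auto
  then show ?thesis
    unfolding cofactor_def factored_def[abs_def] by (intro analytic_on_prod) auto
qed

lemma principal_part_continuous:
  assumes "x \<noteq> a"
  shows "(principal_part h a \<mu> \<longlongrightarrow> principal_part h a \<mu> x) (at x)"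
  unfolding principal_part_def[abs_def] using assms by (intro tendsto_intros) auto

lemma principal_part_at_infinity: "(principal_part h a \<mu> \<longlongrightarrow> 0) at_infinity"
proof -
  have lin: "filterlim (\<lambda>z. z - a) at_infinity at_infinity"
    using tendsto_add_filterlim_at_infinity'[OF filterlim_ident tendsto_const, of "- a"] by simp
  have "((\<lambda>z. (deriv ^^ j) h a / fact j / (z - a) ^ (\<mu> - j)) \<longlongrightarrow> 0) at_infinity" if "j < \<mu>" for j
    using that by (intro tendsto_divide_0[OF tendsto_const] filterlim_compose[OF filterlim_power_at_infinity lin]) auto
  then have "((\<lambda>z. \<Sum>j<\<mu>. (deriv ^^ j) h a / fact j / (z - a) ^ (\<mu> - j)) \<longlongrightarrow> (\<Sum>j<\<mu>. 0)) at_infinity"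
    by (intro tendsto_sum) auto
  then show ?thesis by (simp add: principal_part_def[abs_def])
qed

text \<open>The constant term of the Laurent expansion, which yields the coefficient of a critical value in the velocity
  of its own critical point.\<close>

lemma principal_part_remainder:
  assumes "h analytic_on {a}"
  shows "((\<lambda>z. h z / (z - a) ^ \<mu> - principal_part h a \<mu> z) \<longlongrightarrow> (deriv ^^ \<mu>) h a / fact \<mu>) (at a)"
proof (rule tendsto_transform_eq[OF taylor_remainder_limit[OF assms, of \<mu>]])
  have "\<forall>\<^sub>F z in at a. z \<noteq> a"
    by (simp add: eventually_at_filter)
  then show "\<forall>\<^sub>F z in at a. (h z - (\<Sum>j<\<mu>. (deriv ^^ j) h a / fact j * (z - a) ^ j)) / (z - a) ^ \<mu>
      = h z / (z - a) ^ \<mu> - principal_part h a \<mu> z"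
  proof eventually_elim
    case (elim z)
    have "(deriv ^^ j) h a / fact j * (z - a) ^ j / (z - a) ^ \<mu> = (deriv ^^ j) h a / fact j / (z - a) ^ (\<mu> - j)"
      if "j < \<mu>" for j
      using that elim by (simp add: power_diff)
    then show ?case
      by (simp add: principal_part_def diff_divide_distrib sum_divide_distrib)
  qed
qed simp

text \<open>The difference of \<open>\<Phi>/f\<close> and its principal parts at the zeros of \<open>f\<close> is bounded near all points \<open>c i\<close> and
  vanishes at infinity, hence is \<open>0\<close>. Its limit at \<open>c i\<close> consists of \<open>- v i\<close>, of the constant term of
  \<open>\<alpha> i / f\<close> if \<open>c i\<close> is a zero, and of the values of the principal parts belonging to the other zeros.\<close>

theorem velocity_from_critical_values:
  fixes I :: "'i set" and c v \<alpha> :: "'i \<Rightarrow> complex" and e :: "'i \<Rightarrow> int"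
  defines "h \<equiv> cofactor I e c"
  assumes fin: "finite I" and e: "\<And>i. i \<in> I \<Longrightarrow> e i \<noteq> 0" and inj: "inj_on c I"
    and der: "\<And>z. z \<notin> c ` {i\<in>I. e i < 0} \<Longrightarrow> (\<Phi> has_field_derivative factored_dot I e c v z) (at z)"
    and crit: "\<And>k. k \<in> I \<Longrightarrow> e k > 0 \<Longrightarrow> \<Phi> (c k) = \<alpha> k"
    and center: "(\<Sum>i\<in>I. of_int (e i) * v i) = 0"
    and inf: "(\<Sum>i\<in>I. e i) \<le> 0 \<Longrightarrow> (\<Phi> \<longlongrightarrow> 0) at_infinity"
    and i: "i \<in> I"
  shows "v i = (if e i > 0 then (deriv ^^ nat (e i)) (h i) (c i) / fact (nat (e i)) * \<alpha> i else 0)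
    + (\<Sum>k\<in>{k\<in>I. e k > 0} - {i}.
        (deriv ^^ (nat (e k) - 1)) (\<lambda>x. h k x / (x - c i)) (c k) / fact (nat (e k) - 1) * \<alpha> k)"
proof -
  define K where "K = {k\<in>I. e k > 0}"
  have finK: "finite K" using fin by (simp add: K_def)
  define PP where "PP k = principal_part (h k) (c k) (nat (e k))" for k
  let ?f = "factored I e c" and ?L = "log_dot I e c v"
  let ?S = "c ` I"
  define g where "g z = \<Phi> z / ?f z - (\<Sum>k\<in>K. \<alpha> k * PP k z)" for z
  define l where "l j = - v j + (if e j > 0 then \<alpha> j * ((deriv ^^ nat (e j)) (h j) (c j) / fact (nat (e j))) else 0)
      - (\<Sum>k\<in>K - {j}. \<alpha> k * PP k (c j))" for j
  have finS: "finite ?S" using fin by simp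
  have neq: "c j \<noteq> c k" if "j \<in> I" "k \<in> I" "j \<noteq> k" for j k
    using inj_onD[OF inj, of j k] that by auto
  have f_nz: "?f z \<noteq> 0" if "z \<notin> ?S" for z
    using that by (intro factored_nonzero fin) auto
  have der': "(\<Phi> has_field_derivative ?f z * ?L z) (at z)" if "z \<notin> ?S" for z
  proof -
    have "(\<Phi> has_field_derivative factored_dot I e c v z) (at z)" by (rule der) (use that in auto)
    also have "factored_dot I e c v z = ?f z * ?L z" by (rule factored_dot_eq[OF fin]) (use that in auto)
    finally show ?thesis .
  qed
  have punct: "\<forall>\<^sub>F z in at x. z \<notin> ?S" for x
    using islimpt_finite[OF finS, of x] unfolding islimpt_iff_eventually by simp
  have hol: "g holomorphic_on - ?S"
  proof -
    have "\<Phi> holomorphic_on - ?S"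
      using der' by (subst holomorphic_on_open) (auto intro: finite_imp_closed[OF finS])
    moreover have "?f holomorphic_on - ?S"
      unfolding factored_def[abs_def] by (intro holomorphic_intros) auto
    moreover have "PP k holomorphic_on - ?S" if "k \<in> K" for k
      using that unfolding PP_def principal_part_def[abs_def] K_def by (intro holomorphic_intros) auto
    ultimately show ?thesis
      unfolding g_def[abs_def] using f_nz by (intro holomorphic_intros) auto
  qed
  have lim: "(g \<longlongrightarrow> l j) (at (c j))" if j: "j \<in> I" for j
  proof -
    have others: "((\<lambda>z. \<Sum>k\<in>K - {j}. \<alpha> k * PP k z) \<longlongrightarrow> (\<Sum>k\<in>K - {j}. \<alpha> k * PP k (c j))) (at (c j))"
      unfolding PP_def
      by (intro tendsto_sum tendsto_mult tendsto_const principal_part_continuous)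
        (use j neq in \<open>auto simp: K_def\<close>)
    \<comment> \<open>the constant to be removed from \<open>\<Phi>\<close> so that both kinds of points obey the same local rule\<close>
    define \<beta> where "\<beta> = (if e j > 0 then \<alpha> j else 0)"
    have fz: "factored (I - {j}) e c (c j) \<noteq> 0"
      by (rule factored_nonzero) (use fin j neq in auto)
    have quot: "((\<lambda>z. (\<Phi> z - \<beta>) / ?f z) \<longlongrightarrow> - v j) (at (c j))"
    proof (rule quotient_limit_at_divisor[where f = ?f and L = ?L and p = "e j"
          and \<Phi>' = "\<lambda>z. ?f z * ?L z"])
      show "\<forall>\<^sub>F z in at (c j). ((\<lambda>z. \<Phi> z - \<beta>) has_field_derivative ?f z * ?L z) (at z)"
        using punct by eventually_elim (auto intro!: derivative_eq_intros der')
      assume pos: "e j > 0"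
      have "c j \<notin> c ` {i\<in>I. e i < 0}"
        using pos neq[OF j] by fastforce
      then have "isCont \<Phi> (c j)" using der DERIV_isCont by blast
      then have "(\<Phi> \<longlongrightarrow> \<alpha> j) (at (c j))"
        using crit[OF j pos] by (simp add: isCont_def)
      then show "((\<lambda>z. \<Phi> z - \<beta>) \<longlongrightarrow> 0) (at (c j))"
        using pos by (simp add: \<beta>_def LIM_zero)
    qed (use e[OF j] fz factored_asymptotics_at_divisor[OF fin j inj] log_dot_at_divisor[OF fin j inj]
        in simp_all)
    show ?thesis
    proof (cases "e j > 0")
      case True
      have "((\<lambda>z. (\<Phi> z - \<beta>) / ?f z + \<alpha> j * (h j z / (z - c j) ^ nat (e j) - PP j z)
            - (\<Sum>k\<in>K - {j}. \<alpha> k * PP k z))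
          \<longlongrightarrow> - v j + \<alpha> j * ((deriv ^^ nat (e j)) (h j) (c j) / fact (nat (e j)))
            - (\<Sum>k\<in>K - {j}. \<alpha> k * PP k (c j))) (at (c j))"
        unfolding PP_def[of j] h_def
        by (intro tendsto_diff tendsto_add tendsto_mult tendsto_const quot principal_part_remainder
            cofactor_analytic inj j others[unfolded h_def])
      then show ?thesis
      proof (rule tendsto_transform_eq)
        show "\<forall>\<^sub>F z in at (c j). (\<Phi> z - \<beta>) / ?f z + \<alpha> j * (h j z / (z - c j) ^ nat (e j) - PP j z)
            - (\<Sum>k\<in>K - {j}. \<alpha> k * PP k z) = g z"
          using punct
        proof eventually_elim
          case (elim z)
          have "h j z / (z - c j) ^ nat (e j) = 1 / ?f z"
            using True by (simp add: h_def cofactor_eq factored_remove[OF fin j] power_int_def field_simps)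
          moreover have "(\<Sum>k\<in>K. \<alpha> k * PP k z) = \<alpha> j * PP j z + (\<Sum>k\<in>K - {j}. \<alpha> k * PP k z)"
            by (rule sum.remove[OF finK]) (use True j in \<open>simp add: K_def\<close>)
          ultimately show ?case
            using True by (simp add: g_def \<beta>_def diff_divide_distrib algebra_simps)
        qed
      qed (use True in \<open>simp add: l_def\<close>)
    next
      case False
      then have "K - {j} = K" by (auto simp: K_def)
      then show ?thesis
        using tendsto_diff[OF quot others] False by (simp add: g_def[abs_def] l_def \<beta>_def)
    qed
  qed
  have "(g \<longlongrightarrow> 0) at_infinity"
  proof -
    have far: "\<forall>\<^sub>F z in at_infinity. z \<notin> ?S"
    proof -
      have "\<forall>\<^sub>F z in at_infinity. \<forall>x\<in>?S. z \<noteq> x"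
        using finS by (intro eventually_ball_finite) (auto simp: eventually_not_equal_at_infinity)
      then show ?thesis by eventually_elim auto
    qed
    have "((\<lambda>z. \<Phi> z / ?f z) \<longlongrightarrow> 0) at_infinity"
    proof (rule quotient_limit_at_infinity[OF factored_asymptotics_at_infinity[OF fin]])
      show "((\<lambda>z. z * ?L z) \<longlongrightarrow> 0) at_infinity"
        using log_dot_at_infinity[of I e c v] center by simp
      show "\<forall>\<^sub>F z in at_infinity. (\<Phi> has_field_derivative ?f z * ?L z) (at z)"
        using far by eventually_elim (rule der')
    qed (use inf in simp_all)
    then have "(g \<longlongrightarrow> 0 - (\<Sum>k\<in>K. \<alpha> k * 0)) at_infinity"
      unfolding g_def[abs_def] PP_def
      by (intro tendsto_diff tendsto_sum tendsto_mult tendsto_const principal_part_at_infinity)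
    then show ?thesis by simp
  qed
  \<comment> \<open>the limits are indexed by \<open>I\<close>, but Liouville's theorem wants them indexed by the points\<close>
  have "l (the_inv_into I c x) = 0" if "x \<in> ?S" for x
  proof (rule Liouville_removable[OF finS hol _ \<open>(g \<longlongrightarrow> 0) at_infinity\<close> that])
    show "(g \<longlongrightarrow> l (the_inv_into I c x)) (at x)" if "x \<in> ?S" for x
      using lim that by (auto simp: the_inv_into_f_f[OF inj])
  qed
  from this[of "c i"] have "l i = 0"
    using i by (simp add: the_inv_into_f_f[OF inj])
  moreover have "\<alpha> k * PP k (c i) =
      - ((deriv ^^ (nat (e k) - 1)) (\<lambda>x. h k x / (x - c i)) (c k) / fact (nat (e k) - 1) * \<alpha> k)"
    if "k \<in> K - {i}" for k
  proof -
    have "(deriv ^^ (nat (e k) - 1)) (\<lambda>x. h k x / (x - c i)) (c k) / fact (nat (e k) - 1) = - PP k (c i)"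
      unfolding PP_def h_def
      by (rule principal_part_eq_higher_deriv[OF cofactor_analytic[OF inj]])
        (use that i neq in \<open>auto simp: K_def\<close>)
    then show ?thesis by simp
  qed
  ultimately show ?thesis
    unfolding l_def K_def[symmetric] by (cases "e i > 0") (simp_all add: sum_negf algebra_simps)
qed

section \<open>Families of functions with moving zeros and poles of the derivative\<close>

text \<open>Derivatives in time are taken within \<open>T\<close>. They are unique by \<open>T_limit\<close>, also at end points of \<open>T\<close>, and
  continuity of the velocities is what differentiation under the integral sign requires.\<close>

locale divisor_family =
  fixes T :: "real set" and I :: "'i set" and e :: "'i \<Rightarrow> int"
    and c c' :: "'i \<Rightarrow> real \<Rightarrow> complex" and R :: "complex \<Rightarrow> real \<Rightarrow> complex"
  assumes convex_T: "convex T"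
    and T_limit: "\<And>t. t \<in> T \<Longrightarrow> at t within T \<noteq> bot"
    and finite_I: "finite I"
    and e_nonzero: "\<And>i. i \<in> I \<Longrightarrow> e i \<noteq> 0"
    and c_deriv: "\<And>i t. i \<in> I \<Longrightarrow> t \<in> T \<Longrightarrow> (c i has_vector_derivative c' i t) (at t within T)"
    and c'_cont: "\<And>i. i \<in> I \<Longrightarrow> continuous_on T (c' i)"
    and c_inj: "\<And>t. t \<in> T \<Longrightarrow> inj_on (\<lambda>i. c i t) I"
    and R_has_deriv: "\<And>t z. t \<in> T \<Longrightarrow> z \<notin> (\<lambda>i. c i t) ` {i\<in>I. e i < 0} \<Longrightarrow>
          ((\<lambda>z. R z t) has_field_derivative factored I e (\<lambda>i. c i t) z) (at z)"
begin

definition poles :: "real \<Rightarrow> complex set" where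
  "poles t = (\<lambda>i. c i t) ` {i\<in>I. e i < 0}"

abbreviation f where "f t \<equiv> factored I e (\<lambda>i. c i t)"
abbreviation fdot where "fdot t \<equiv> factored_dot I e (\<lambda>i. c i t) (\<lambda>i. c' i t)"

lemma R_deriv: "t \<in> T \<Longrightarrow> z \<notin> poles t \<Longrightarrow> ((\<lambda>z. R z t) has_field_derivative f t z) (at z)"
  using R_has_deriv unfolding poles_def by blast

lemma finite_poles: "finite (poles t)"
  unfolding poles_def using finite_I by simp

lemma c_cont: "i \<in> I \<Longrightarrow> continuous_on T (c i)"
  using c_deriv has_vector_derivative_continuous continuous_on_eq_continuous_within by blast

lemma open_compl_poles: "open (- poles t)"
  using finite_poles finite_imp_closed open_Compl by blast

lemma ball_avoiding_poles:
  assumes "z \<notin> poles t"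
  obtains r where "r > 0" "cball z r \<subseteq> - poles t"
  using assms open_compl_poles[of t] open_contains_cball[of "- poles t"] by auto

text \<open>Taking \<open>K\<close> closed rather than compact also covers the exterior of a circle, which is the form needed at
  infinity.\<close>

lemma eventually_poles_avoid:
  assumes K: "closed K" and t: "t \<in> T" and disj: "K \<inter> poles t = {}"
  shows "\<forall>\<^sub>F s in nhds t. s \<in> T \<longrightarrow> K \<inter> poles s = {}"
proof -
  have "\<forall>\<^sub>F s in nhds t. s \<in> T \<longrightarrow> c i s \<in> - K" if "i \<in> {i\<in>I. e i < 0}" for i
  proof -
    have "c i t \<in> - K" using disj that by (auto simp: poles_def)
    moreover have "(c i \<longlongrightarrow> c i t) (at t within T)"
      using c_cont that t by (auto simp: continuous_on_def)
    ultimately have "\<forall>\<^sub>F s in at t within T. c i s \<in> - K"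
      using K topological_tendstoD open_Compl by blast
    then show ?thesis
      unfolding eventually_at_filter
      by eventually_elim (use \<open>c i t \<in> - K\<close> in auto)
  qed
  then have "\<forall>\<^sub>F s in nhds t. \<forall>i\<in>{i\<in>I. e i < 0}. s \<in> T \<longrightarrow> c i s \<in> - K"
    using finite_I by (intro eventually_ball_finite) auto
  then show ?thesis
    by eventually_elim (auto simp: poles_def)
qed

lemma poles_avoid:
  assumes "closed K" "t \<in> T" "K \<inter> poles t = {}"
  obtains \<delta> where "\<delta> > 0" "\<And>s. s \<in> T \<Longrightarrow> dist s t < \<delta> \<Longrightarrow> K \<inter> poles s = {}"
  using eventually_poles_avoid[OF assms] unfolding eventually_nhds_metric by auto

lemma fdot_holomorphic_on:
  assumes "X \<inter> poles t = {}"
  shows "fdot t holomorphic_on X"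
  using assms by (intro factored_dot_holomorphic e_nonzero) (auto simp: poles_def)

lemma curve_integral_derivative:
  fixes k z :: "real \<Rightarrow> complex"
  assumes t: "t \<in> T" and k: "continuous_on {0..1} k" and z: "continuous_on {0..1} z"
    and avoid: "z ` {0..1} \<inter> poles t = {}"
  shows "((\<lambda>s. integral {0..1} (\<lambda>\<theta>. k \<theta> * f s (z \<theta>))) has_vector_derivative
           integral {0..1} (\<lambda>\<theta>. k \<theta> * fdot t (z \<theta>))) (at t within T)"
proof -
  have "closed (z ` {0..1})"
    using z by (intro compact_imp_closed compact_continuous_image) auto
  then obtain \<delta> where \<delta>: "\<delta> > 0" "\<And>s. s \<in> T \<Longrightarrow> dist s t < \<delta> \<Longrightarrow> z ` {0..1} \<inter> poles s = {}"
    using poles_avoid t avoid by metis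
  define U where "U = T \<inter> ball t \<delta>"
  have U: "U \<subseteq> T" "t \<in> U" "convex U"
    using t \<delta> convex_T by (auto simp: U_def intro: convex_Int)
  have av: "z \<theta> \<noteq> c i s" if "s \<in> U" "\<theta> \<in> {0..1}" "i \<in> I" "e i < 0" for s \<theta> i
  proof
    assume "z \<theta> = c i s"
    then have "z \<theta> \<in> z ` {0..1} \<inter> poles s" using that by (simp add: poles_def) (metis atLeastAtMost_iff imageI)
    moreover have "z ` {0..1} \<inter> poles s = {}"
      using \<delta>(2)[of s] that by (simp add: U_def dist_commute)
    ultimately show False by blast
  qed
  have "((\<lambda>s. integral (cbox 0 1) (\<lambda>\<theta>. k \<theta> * f s (z \<theta>))) has_vector_derivative
           integral (cbox 0 1) (\<lambda>\<theta>. k \<theta> * fdot t (z \<theta>))) (at t within U)"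
  proof (rule leibniz_rule_vector_derivative[where fx = "\<lambda>s \<theta>. k \<theta> * fdot s (z \<theta>)", OF _ _ _ U(2,3)])
    fix s \<theta> assume "s \<in> U" "\<theta> \<in> cbox 0 (1::real)"
    then show "((\<lambda>s. k \<theta> * f s (z \<theta>)) has_vector_derivative k \<theta> * fdot s (z \<theta>)) (at s within U)"
      using av has_vector_derivative_within_subset[OF c_deriv U(1)] U(1)
      by (intro has_vector_derivative_mult_right factored_has_derivative_in_divisor) auto
  next
    fix s assume "s \<in> U"
    then show "(\<lambda>\<theta>. k \<theta> * f s (z \<theta>)) integrable_on cbox 0 1"
      using av by (intro integrable_continuous continuous_on_mult continuous_on_factored)
        (use k z in auto)
  next
    have sub: "continuous_on (U \<times> {0..1}) (\<lambda>x. g (snd x))" if "continuous_on {0..1} g" for g :: "real \<Rightarrow> complex"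
      by (rule continuous_on_compose2[OF that]) (auto intro!: continuous_intros)
    have subT: "continuous_on (U \<times> {0..1::real}) (\<lambda>x. g (fst x))" if "continuous_on T g" for g :: "real \<Rightarrow> complex"
      by (rule continuous_on_compose2[OF that]) (use U(1) in \<open>auto intro!: continuous_intros\<close>)
    have "continuous_on (U \<times> {0..1}) (\<lambda>x. k (snd x) *
        factored_dot I e (\<lambda>i. c i (fst x)) (\<lambda>i. c' i (fst x)) (z (snd x)))"
      by (intro continuous_on_mult continuous_on_factored_dot e_nonzero sub subT k z c_cont c'_cont)
        (use av in auto)
    then show "continuous_on (U \<times> cbox 0 1) (\<lambda>(s, \<theta>). k \<theta> * fdot s (z \<theta>))"
      by (simp add: case_prod_unfold)
  qed
  moreover have "at t within U = at t within T"
    unfolding U_def by (rule at_within_nhd[of _ "ball t \<delta>"]) (use \<delta> in auto)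
  ultimately show ?thesis by simp
qed

text \<open>For times near \<open>t\<close> no pole lies on the segment, so the difference is the integral of \<open>f s\<close> along it.\<close>

lemma R_difference_derivative:
  assumes t: "t \<in> T" and seg: "closed_segment z\<^sub>1 z\<^sub>2 \<inter> poles t = {}"
  shows "((\<lambda>s. R z\<^sub>2 s - R z\<^sub>1 s) has_vector_derivative contour_integral (linepath z\<^sub>1 z\<^sub>2) (fdot t))
           (at t within T)"
proof -
  obtain \<delta> where \<delta>: "\<delta> > 0" "\<And>s. s \<in> T \<Longrightarrow> dist s t < \<delta> \<Longrightarrow> closed_segment z\<^sub>1 z\<^sub>2 \<inter> poles s = {}"
    using poles_avoid[OF closed_segment t seg] by metis
  have im: "linepath z\<^sub>1 z\<^sub>2 ` {0..1} = closed_segment z\<^sub>1 z\<^sub>2"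
    by (simp add: linepath_image_01)
  have D: "((\<lambda>s. integral {0..1} (\<lambda>\<theta>. (z\<^sub>2 - z\<^sub>1) * f s (linepath z\<^sub>1 z\<^sub>2 \<theta>))) has_vector_derivative
           integral {0..1} (\<lambda>\<theta>. (z\<^sub>2 - z\<^sub>1) * fdot t (linepath z\<^sub>1 z\<^sub>2 \<theta>))) (at t within T)"
    by (rule curve_integral_derivative[OF t]) (use seg im in auto)
  have eq: "integral {0..1} (\<lambda>\<theta>. (z\<^sub>2 - z\<^sub>1) * f s (linepath z\<^sub>1 z\<^sub>2 \<theta>)) = R z\<^sub>2 s - R z\<^sub>1 s"
    if "s \<in> T" "dist s t < \<delta>" for s
  proof -
    have "(f s has_contour_integral R (pathfinish (linepath z\<^sub>1 z\<^sub>2)) s - R (pathstart (linepath z\<^sub>1 z\<^sub>2)) s) (linepath z\<^sub>1 z\<^sub>2)"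
    proof (rule contour_integral_primitive[where S = "closed_segment z\<^sub>1 z\<^sub>2"])
      fix x assume "x \<in> closed_segment z\<^sub>1 z\<^sub>2"
      then have "x \<notin> poles s" using \<delta>(2)[OF that] by blast
      then show "((\<lambda>z. R z s) has_field_derivative f s x) (at x within closed_segment z\<^sub>1 z\<^sub>2)"
        using R_deriv[OF that(1)] has_field_derivative_at_within by blast
    qed auto
    then have "((\<lambda>\<theta>. (z\<^sub>2 - z\<^sub>1) * f s (linepath z\<^sub>1 z\<^sub>2 \<theta>)) has_integral R z\<^sub>2 s - R z\<^sub>1 s) {0..1}"
      by (simp add: has_contour_integral_linepath mult.commute)
    then show ?thesis by (rule integral_unique)
  qed
  have C: "integral {0..1} (\<lambda>\<theta>. (z\<^sub>2 - z\<^sub>1) * fdot t (linepath z\<^sub>1 z\<^sub>2 \<theta>))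
      = contour_integral (linepath z\<^sub>1 z\<^sub>2) (fdot t)"
    by (simp add: contour_integral_integral mult.commute)
  show ?thesis
    using has_vector_derivative_transform_within[OF D \<delta>(1) t eq] unfolding C by blast
qed

text \<open>Connectedness of the complement of the finitely many poles: by the previous lemma, differentiability of
  differences is a locally trivial equivalence relation.\<close>

lemma R_differentiable_transfer:
  assumes t: "t \<in> T" and z: "z\<^sub>0 \<notin> poles t" "z \<notin> poles t"
    and diff: "R z\<^sub>0 differentiable (at t within T)"
  shows "R z differentiable (at t within T)"
proof -
  have "(\<lambda>s. R z s - R z\<^sub>0 s) differentiable (at t within T)"
  proof (rule connected_equivalence_relation[where S = "- poles t"
        and R = "\<lambda>x y. (\<lambda>s. R y s - R x s) differentiable (at t within T)"])
    show "connected (- poles t)"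
      using connected_open_delete_finite[of UNIV "poles t"] finite_poles
      by (simp add: Compl_eq_Diff_UNIV connected_UNIV)
    show "\<And>x y. (\<lambda>s. R y s - R x s) differentiable (at t within T) \<Longrightarrow> 
        (\<lambda>s. R x s - R y s) differentiable (at t within T)"
      using differentiable_minus[of "\<lambda>s. R y s - R x s" for x y] by force
    show "(\<lambda>s. R y s - R x s) differentiable (at t within T) \<Longrightarrow>
        (\<lambda>s. R z s - R y s) differentiable (at t within T) \<Longrightarrow>
        (\<lambda>s. R z s - R x s) differentiable (at t within T)" for x y z
      using differentiable_add[of "\<lambda>s. R y s - R x s" _ "\<lambda>s. R z s - R y s"] by force
    fix x assume "x \<in> - poles t"
    then obtain r where r: "r > 0" "cball x r \<subseteq> - poles t"
      using ball_avoiding_poles[of x t] by auto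
    have "(\<lambda>s. R y s - R x s) differentiable (at t within T)" if "y \<in> ball x r" for y
    proof -
      have "closed_segment x y \<subseteq> ball x r"
        using that r by (intro closed_segment_subset) auto
      then show ?thesis
        using R_difference_derivative[OF t, of x y] r(2) ball_subset_cball[of x r]
        by (intro differentiableI_vector) blast
    qed
    moreover have "ball x r \<subseteq> - poles t"
      using r ball_subset_cball[of x r] by blast
    ultimately show "\<exists>X. openin (top_of_set (- poles t)) X \<and> x \<in> X \<and>
        (\<forall>y\<in>X. (\<lambda>s. R y s - R x s) differentiable (at t within T))"
      using r open_compl_poles
      by (intro exI[of _ "ball x r"]) (auto simp: openin_open_eq)
  qed (use z in auto)
  from differentiable_add[OF this diff] show ?thesis by simp
qed

definition Rdot :: "real \<Rightarrow> complex \<Rightarrow> complex" where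
  "Rdot t z = vector_derivative (R z) (at t within T)"

lemma Rdot_works:
  assumes "t \<in> T" "R z differentiable (at t within T)"
  shows "(R z has_vector_derivative Rdot t z) (at t within T)"
  using assms vector_derivative_works unfolding Rdot_def by blast

lemma Rdot_unique:
  assumes "t \<in> T" "(R z has_vector_derivative x) (at t within T)"
  shows "Rdot t z = x"
  unfolding Rdot_def using assms T_limit vector_derivative_within by blast

text \<open>Locally \<open>Rdot t\<close> differs by a constant from a primitive of \<open>fdot t\<close>, because increments along segments are
  integrals of \<open>fdot t\<close>.\<close>

lemma Rdot_has_field_derivative:
  assumes t: "t \<in> T" and diff: "\<And>z. z \<notin> poles t \<Longrightarrow> R z differentiable (at t within T)"
    and z: "z \<notin> poles t"
  shows "(Rdot t has_field_derivative fdot t z) (at z)"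
proof -
  obtain r where r: "r > 0" "cball z r \<subseteq> - poles t"
    using ball_avoiding_poles[OF z] by blast
  have hol: "fdot t holomorphic_on ball z r"
    by (rule fdot_holomorphic_on) (use r ball_subset_cball[of z r] in blast)
  obtain F where F: "\<And>x. x \<in> ball z r \<Longrightarrow> (F has_field_derivative fdot t x) (at x within ball z r)"
    using holomorphic_convex_primitive'[OF convex_ball open_ball hol] by blast
  have eq: "Rdot t x = Rdot t z + (F x - F z)" if x: "x \<in> ball z r" for x
  proof -
    have seg: "closed_segment z x \<subseteq> ball z r"
      using x r by (intro closed_segment_subset) auto
    have "(fdot t has_contour_integral F (pathfinish (linepath z x)) - F (pathstart (linepath z x))) (linepath z x)"
      by (rule contour_integral_primitive[OF F]) (use seg in auto)
    then have "contour_integral (linepath z x) (fdot t) = F x - F z"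
      by (simp add: contour_integral_unique)
    moreover have "closed_segment z x \<inter> poles t = {}"
      using seg r ball_subset_cball[of z r] by blast
    then have "((\<lambda>s. R x s - R z s) has_vector_derivative contour_integral (linepath z x) (fdot t)) (at t within T)"
      by (rule R_difference_derivative[OF t])
    ultimately have "((\<lambda>s. (R x s - R z s) + R z s) has_vector_derivative (F x - F z) + Rdot t z) (at t within T)"
      using Rdot_works[OF t diff[OF z]] by (intro has_vector_derivative_add) simp_all
    then show ?thesis
      using Rdot_unique[OF t] by (simp add: add.commute)
  qed
  have "((\<lambda>x. Rdot t z + (F x - F z)) has_field_derivative fdot t z) (at z)"
    using F[of z] r by (auto intro!: derivative_eq_intros simp: at_within_open[OF _ open_ball])
  then show ?thesis
    by (rule has_field_derivative_transform_within_open[OF _ open_ball, of _ _ _ z r])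
      (use r eq[symmetric] in auto)
qed

text \<open>Letting the point of evaluation follow a zero of \<open>f\<close> is invisible to first order: the point moves by
  \<open>O(s - t)\<close>, and on the way the derivative \<open>f\<close> of \<open>R\<close> tends to \<open>0\<close>.\<close>

lemma moving_point_derivative:
  assumes t: "t \<in> T" and i: "i \<in> I" "e i > 0"
  shows "((\<lambda>s. R (c i s) s - R (c i t) s) has_vector_derivative 0) (at t within T)"
proof -
  define a where "a = c i t"
  have a: "a \<notin> poles t"
  proof
    assume "a \<in> poles t"
    then obtain j where j: "a = c j t" "j \<in> {i\<in>I. e i < 0}"
      unfolding poles_def by (rule imageE)
    have "i = j"
      by (rule inj_onD[OF c_inj[OF t]]) (use i(1) j in \<open>simp_all add: a_def\<close>)
    then show False using i(2) j(2) by simp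
  qed
  have fa: "f t a = 0"
    using i by (simp add: factored_remove[OF finite_I i(1)] a_def)
  obtain r where r: "r > 0" "cball a r \<subseteq> - poles t"
    using ball_avoiding_poles[OF a] by blast
  obtain \<delta>\<^sub>0 where \<delta>\<^sub>0: "\<delta>\<^sub>0 > 0" "\<And>s. s \<in> T \<Longrightarrow> dist s t < \<delta>\<^sub>0 \<Longrightarrow> cball a r \<inter> poles s = {}"
    using poles_avoid[OF closed_cball t, of a r] r by blast
  define U where "U = T \<inter> ball t \<delta>\<^sub>0"
  have tU: "t \<in> U" using t \<delta>\<^sub>0 by (simp add: U_def)
  have fc: "continuous_on (U \<times> cball a r) (\<lambda>x. f (fst x) (snd x))"
  proof (rule continuous_on_factored)
    show "continuous_on (U \<times> cball a r) (\<lambda>x. c i (fst x))" if "i \<in> I" for i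
      by (rule continuous_on_compose2[OF c_cont[OF that] continuous_on_fst[OF continuous_on_id]])
        (auto simp: U_def)
    show "snd x \<noteq> c i (fst x)" if "i \<in> I" "e i < 0" "x \<in> U \<times> cball a r" for i x
    proof
      assume "snd x = c i (fst x)"
      then have "snd x \<in> cball a r \<inter> poles (fst x)" using that by (auto simp: poles_def)
      moreover have "cball a r \<inter> poles (fst x) = {}"
        by (rule \<delta>\<^sub>0(2)) (use that in \<open>auto simp: U_def dist_commute\<close>)
      ultimately show False by blast
    qed
  qed (intro continuous_intros)
  define K where "K = norm (c' i t) + 1"
  have K: "K > 0" by (simp add: K_def add_nonneg_pos)
  obtain \<delta>\<^sub>1 where \<delta>\<^sub>1: "\<delta>\<^sub>1 > 0"
    and lin: "\<And>s. s \<in> T \<Longrightarrow> norm (s - t) < \<delta>\<^sub>1 \<Longrightarrow>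
        norm (c i s - c i t - (s - t) *\<^sub>R c' i t) \<le> 1 * norm (s - t)"
    using c_deriv[OF i(1) t] zero_less_one
    unfolding has_vector_derivative_def has_derivative_within_alt by blast
  have lip: "norm (c i s - a) \<le> K * norm (s - t)" if "s \<in> T" "norm (s - t) < \<delta>\<^sub>1" for s
  proof -
    have "norm (c i s - a) \<le> norm (c i s - c i t - (s - t) *\<^sub>R c' i t) + \<bar>s - t\<bar> * norm (c' i t)"
      using norm_triangle_ineq[of "c i s - c i t - (s - t) *\<^sub>R c' i t" "(s - t) *\<^sub>R c' i t"]
      unfolding a_def by (simp only: diff_add_cancel norm_scaleR)
    also have "\<dots> \<le> norm (s - t) + \<bar>s - t\<bar> * norm (c' i t)"
      using lin[OF that] by simp
    finally show ?thesis by (simp add: K_def algebra_simps)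
  qed
  have "norm (R (c i s) s - R a s) \<le> \<epsilon> * norm (s - t)"
    if "d > 0" and s: "s \<in> T" "norm (s - t) < \<delta>\<^sub>1" "norm (s - t) < \<delta>\<^sub>0" "norm (s - t) < d / 2"
      "norm (s - t) < min (d / 2) r / K"
      and d: "\<And>x. x \<in> U \<times> cball a r \<Longrightarrow> dist x (t, a) < d \<Longrightarrow> norm (f (fst x) (snd x)) \<le> \<epsilon> / K"
    for \<epsilon> d s
  proof -
    have "K * norm (s - t) < min (d / 2) r"
      using s(5) K by (simp only: pos_less_divide_eq mult.commute)
    then have near: "norm (c i s - a) < min (d / 2) r"
      using lip[OF s(1,2)] by linarith
    have seg: "closed_segment (c i s) a \<subseteq> ball a (min (d / 2) r)"
      using near \<open>d > 0\<close> r by (intro closed_segment_subset) (auto simp: dist_norm norm_minus_commute)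
    have sU: "s \<in> U" using s by (simp add: U_def dist_norm abs_minus_commute)
    have "norm (R (c i s) s - R a s) \<le> \<epsilon> / K * norm (c i s - a)"
    proof (rule field_differentiable_bound[OF convex_closed_segment[of "c i s" a]])
      fix z assume "z \<in> closed_segment (c i s) a"
      then have z: "dist a z < min (d / 2) r" using seg by auto
      have "cball a r \<inter> poles s = {}"
        using \<delta>\<^sub>0(2)[of s] s by (simp add: dist_norm)
      moreover have "z \<in> cball a r" using z by auto
      ultimately have "z \<notin> poles s" by blast
      then show "((\<lambda>z. R z s) has_field_derivative f s z) (at z within closed_segment (c i s) a)"
        using R_deriv[OF s(1)] has_field_derivative_at_within by blast
      have "dist (s, z) (t, a) \<le> dist s t + dist z a"
        by (simp add: dist_Pair_Pair sqrt_sum_squares_le_sum)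
      also have "\<dots> < d" using z s by (simp add: dist_norm norm_minus_commute)
      finally show "norm (f s z) \<le> \<epsilon> / K"
        using d[of "(s, z)"] sU z by simp
    qed auto
    also have "\<dots> \<le> \<epsilon> / K * (K * norm (s - t))"
      using lip[OF s(1,2)] d[of "(t, a)"] tU r \<open>d > 0\<close> fa by (intro mult_left_mono) auto
    finally show ?thesis using K by simp
  qed
  note bound = this
  show ?thesis
    unfolding has_vector_derivative_def has_derivative_within_alt
  proof (intro conjI allI impI)
    fix \<epsilon> :: real assume \<epsilon>: "\<epsilon> > 0"
    have "(t, a) \<in> U \<times> cball a r" using tU r by simp
    then obtain d where d: "d > 0" "\<And>x. x \<in> U \<times> cball a r \<Longrightarrow> dist x (t, a) < d \<Longrightarrow>
        dist (f (fst x) (snd x)) (f t a) < \<epsilon> / K"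
      using fc \<epsilon> K unfolding continuous_on_iff by (metis fst_conv snd_conv divide_pos_pos)
    \<comment> \<open>\<open>K\<close> is a Lipschitz constant of \<open>c i\<close> at \<open>t\<close>; the last bound keeps the whole segment from \<open>c i s\<close> to \<open>a\<close> within reach of \<open>d\<close>\<close>
    let ?\<delta> = "min (min \<delta>\<^sub>1 \<delta>\<^sub>0) (min (d / 2) (min (d / 2) r / K))"
    have "?\<delta> > 0" using \<delta>\<^sub>0 \<delta>\<^sub>1 d r K by simp
    moreover have "norm (R (c i s) s - R a s) \<le> \<epsilon> * norm (s - t)" if "s \<in> T" "norm (s - t) < ?\<delta>" for s
      by (rule bound[of d]) (use d that fa in \<open>auto simp: less_imp_le\<close>)
    ultimately show "\<exists>\<delta>>0. \<forall>s\<in>T. norm (s - t) < \<delta> \<longrightarrow>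
        norm (R (c i s) s - R (c i t) s - (R (c i t) t - R (c i t) t) - (s - t) *\<^sub>R 0) \<le> \<epsilon> * norm (s - t)"
      unfolding a_def by (intro exI[of _ ?\<delta>]) simp
  qed (simp add: bounded_linear_zero)
qed

text \<open>Differentiation under the integral sign in the representation over the circle through \<open>z\<^sub>0\<close>. The term
  \<open>c\<^sub>0 * z\<close> covers functions asymptotic to a fixed linear function; it does not depend on time and drops out.\<close>

lemma R_derivative_near_infinity:
  assumes t: "t \<in> T" and lim: "\<And>s. s \<in> T \<Longrightarrow> ((\<lambda>z. R z s - c\<^sub>0 * z) \<longlongrightarrow> 0) at_infinity"
    and z0: "z\<^sub>0 \<noteq> 0" "\<And>p. p \<in> poles t \<Longrightarrow> norm p < norm z\<^sub>0"
  defines "\<gamma> \<equiv> \<lambda>\<theta>::real. z\<^sub>0 * exp (- (2 * of_real pi * \<i> * of_real \<theta>))"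
  shows "(R z\<^sub>0 has_vector_derivative
           integral {0..1} (\<lambda>\<theta>. - (2 * of_real pi * \<i> * of_real \<theta>) * \<gamma> \<theta> * fdot t (\<gamma> \<theta>)))
         (at t within T)"
proof -
  let ?k = "\<lambda>\<theta>. - (2 * of_real pi * \<i> * of_real \<theta>) * \<gamma> \<theta>"
  define K where "K = {z::complex. norm z \<ge> norm z\<^sub>0}"
  have "closed K"
    unfolding K_def by (intro closed_Collect_le continuous_intros)
  moreover have "K \<inter> poles t = {}" using z0(2) by (force simp: K_def)
  ultimately obtain \<delta> where \<delta>: "\<delta> > 0" "\<And>s. s \<in> T \<Longrightarrow> dist s t < \<delta> \<Longrightarrow> K \<inter> poles s = {}"
    using poles_avoid[OF _ t] by metis
  have \<gamma>_cont: "continuous_on {0..1} \<gamma>"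
    unfolding \<gamma>_def by (intro continuous_intros)
  then have k_cont: "continuous_on {0..1} ?k"
    by (intro continuous_intros)
  have \<gamma>K: "\<gamma> \<theta> \<in> K" for \<theta>
    by (simp add: \<gamma>_def K_def norm_mult)
  define J where "J = integral {0..1} (\<lambda>\<theta>. ?k \<theta> * c\<^sub>0)"
  have J: "((\<lambda>\<theta>. ?k \<theta> * c\<^sub>0) has_integral J) {0..1}"
    unfolding J_def
    by (intro integrable_integral integrable_continuous_interval continuous_on_mult[OF k_cont]
        continuous_on_const)
  have D: "((\<lambda>s. integral {0..1} (\<lambda>\<theta>. ?k \<theta> * f s (\<gamma> \<theta>))) has_vector_derivative
      integral {0..1} (\<lambda>\<theta>. ?k \<theta> * fdot t (\<gamma> \<theta>))) (at t within T)"
    by (rule curve_integral_derivative[OF t k_cont \<gamma>_cont]) (use \<open>K \<inter> poles t = {}\<close> \<gamma>K in auto)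
  have eq: "integral {0..1} (\<lambda>\<theta>. ?k \<theta> * f s (\<gamma> \<theta>)) + (c\<^sub>0 * z\<^sub>0 - J) = R z\<^sub>0 s"
    if s: "s \<in> T" "dist s t < \<delta>" for s
  proof -
    have der: "((\<lambda>z. R z s - c\<^sub>0 * z) has_field_derivative f s z - c\<^sub>0) (at z)" if "norm z \<ge> norm z\<^sub>0" for z
    proof -
      have "z \<in> K" using that by (simp add: K_def)
      then have "z \<notin> poles s" using \<delta>(2)[OF s] by blast
      from R_deriv[OF s(1) this] show ?thesis
        by (auto intro!: derivative_eq_intros)
    qed
    have "((\<lambda>\<theta>. ?k \<theta> * (f s (\<gamma> \<theta>) - c\<^sub>0)) has_integral (R z\<^sub>0 s - c\<^sub>0 * z\<^sub>0)) {0..1}"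
      using mean_value_representation_at_infinity[OF z0(1) der lim[OF s(1)]] unfolding \<gamma>_def .
    from has_integral_add[OF this J]
    have "((\<lambda>\<theta>. ?k \<theta> * f s (\<gamma> \<theta>)) has_integral (R z\<^sub>0 s - c\<^sub>0 * z\<^sub>0 + J)) {0..1}"
      by (rule has_integral_eq[rotated]) (simp add: algebra_simps)
    from integral_unique[OF this] show ?thesis by simp
  qed
  have "((\<lambda>s. integral {0..1} (\<lambda>\<theta>. ?k \<theta> * f s (\<gamma> \<theta>)) + (c\<^sub>0 * z\<^sub>0 - J)) has_vector_derivative
      integral {0..1} (\<lambda>\<theta>. ?k \<theta> * fdot t (\<gamma> \<theta>)) + 0) (at t within T)"
    by (intro has_vector_derivative_add D has_vector_derivative_const)
  from has_vector_derivative_transform_within[OF this \<delta>(1) t eq] show ?thesis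
    by simp
qed

lemma fdot_at_infinity:
  assumes deg: "(\<Sum>i\<in>I. e i) \<le> 0" and center: "(\<Sum>i\<in>I. of_int (e i) * c' i t) = 0"
  shows "((\<lambda>z. z * fdot t z) \<longlongrightarrow> 0) at_infinity"
proof -
  let ?d = "\<Sum>i\<in>I. e i"
  have "((\<lambda>z. (f t z / z powi ?d) * inverse z ^ nat (- ?d) * (z * log_dot I e (\<lambda>i. c i t) (\<lambda>i. c' i t) z))
      \<longlongrightarrow> 1 * 0 ^ nat (- ?d) * - (\<Sum>i\<in>I. of_int (e i) * c' i t)) at_infinity"
    by (intro tendsto_intros factored_asymptotics_at_infinity finite_I log_dot_at_infinity tendsto_inverse_0)
  then show ?thesis
  proof (rule tendsto_transform_eq)
    have "\<forall>\<^sub>F z in at_infinity. \<forall>i\<in>insert 0 ((\<lambda>i. c i t) ` I). z \<noteq> i"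
      using finite_I by (intro eventually_ball_finite) (auto simp: eventually_not_equal_at_infinity)
    then show "\<forall>\<^sub>F z in at_infinity. (f t z / z powi ?d) * inverse z ^ nat (- ?d) *
        (z * log_dot I e (\<lambda>i. c i t) (\<lambda>i. c' i t) z) = z * fdot t z"
    proof eventually_elim
      case (elim z)
      have "z powi ?d = inverse z ^ nat (- ?d)"
        using deg by (auto simp: power_int_def)
      moreover have "inverse z ^ nat (- ?d) \<noteq> 0" using elim by simp
      moreover have "fdot t z = f t z * log_dot I e (\<lambda>i. c i t) (\<lambda>i. c' i t) z"
        by (rule factored_dot_eq[OF finite_I]) (use elim in auto)
      ultimately show ?case by simp
    qed
  qed (use center in simp)
qed

lemma eventually_beyond_poles: "\<forall>\<^sub>F z in at_infinity. z \<noteq> 0 \<and> (\<forall>p\<in>poles t. norm p < norm z)"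
proof -
  obtain B where B: "\<And>p. p \<in> poles t \<Longrightarrow> norm p \<le> B"
    using finite_imp_bounded[OF finite_poles] bounded_iff by blast
  have "z \<noteq> 0 \<and> (\<forall>p\<in>poles t. norm p < norm z)" if "norm z \<ge> \<bar>B\<bar> + 1" for z
    using B that by force
  then show ?thesis
    unfolding eventually_at_infinity by blast
qed

text \<open>In the representation over the circle of radius \<open>norm z\<^sub>0\<close> the integrand is bounded by \<open>2 \<pi>\<close> times
  \<open>norm (z * fdot t z)\<close>.\<close>

lemma Rdot_at_infinity:
  assumes t: "t \<in> T" and lim: "\<And>s. s \<in> T \<Longrightarrow> ((\<lambda>z. R z s - c\<^sub>0 * z) \<longlongrightarrow> 0) at_infinity"
    and deg: "(\<Sum>i\<in>I. e i) \<le> 0" and center: "(\<Sum>i\<in>I. of_int (e i) * c' i t) = 0"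
  shows "(Rdot t \<longlongrightarrow> 0) at_infinity"
proof (rule tendstoI)
  fix \<epsilon> :: real assume \<epsilon>: "\<epsilon> > 0"
  define \<eta> where "\<eta> = \<epsilon> / (4 * pi)"
  have "\<eta> > 0" using \<epsilon> by (simp add: \<eta>_def)
  with fdot_at_infinity[OF deg center]
  have "\<forall>\<^sub>F z in at_infinity. norm (z * fdot t z) < \<eta>"
    using tendstoD by fastforce
  then obtain B where B: "\<And>z. norm z \<ge> B \<Longrightarrow> norm (z * fdot t z) < \<eta>"
    unfolding eventually_at_infinity by blast
  have "\<forall>\<^sub>F z in at_infinity. norm (z :: complex) \<ge> B"
    unfolding eventually_at_infinity by blast
  with eventually_beyond_poles[of t] show "\<forall>\<^sub>F z in at_infinity. dist (Rdot t z) 0 < \<epsilon>"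
  proof eventually_elim
    case (elim z\<^sub>0)
    define \<gamma> where "\<gamma> = (\<lambda>\<theta>::real. z\<^sub>0 * exp (- (2 * of_real pi * \<i> * of_real \<theta>)))"
    have n\<gamma>: "norm (\<gamma> \<theta>) = norm z\<^sub>0" for \<theta>
      by (simp add: \<gamma>_def norm_mult)
    have cont: "continuous_on {0..1} (\<lambda>\<theta>. - (2 * of_real pi * \<i> * of_real \<theta>) * \<gamma> \<theta> * fdot t (\<gamma> \<theta>))"
    proof (intro continuous_on_mult)
      show "continuous_on {0..1} \<gamma>" unfolding \<gamma>_def by (intro continuous_intros)
      have "fdot t holomorphic_on - poles t" by (rule fdot_holomorphic_on) simp
      moreover have "\<gamma> ` {0..1} \<subseteq> - poles t" using elim(1) n\<gamma> by force
      ultimately show "continuous_on {0..1} (\<lambda>\<theta>. fdot t (\<gamma> \<theta>))"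
        using \<open>continuous_on {0..1} \<gamma>\<close> continuous_on_compose2 holomorphic_on_imp_continuous_on by blast
    qed (intro continuous_intros)
    have "Rdot t z\<^sub>0 = integral {0..1} (\<lambda>\<theta>. - (2 * of_real pi * \<i> * of_real \<theta>) * \<gamma> \<theta> * fdot t (\<gamma> \<theta>))"
      unfolding \<gamma>_def by (rule Rdot_unique[OF t R_derivative_near_infinity[OF t lim]]) (use elim in auto)
    also have "norm \<dots> \<le> 2 * pi * \<eta> * (1 - 0)"
    proof (rule integral_bound[OF _ cont])
      fix \<theta> :: real assume \<theta>: "\<theta> \<in> {0..1}"
      have "norm (- (2 * of_real pi * \<i> * of_real \<theta>) * \<gamma> \<theta> * fdot t (\<gamma> \<theta>))
          = (2 * pi * \<theta>) * norm (\<gamma> \<theta> * fdot t (\<gamma> \<theta>))"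
        using \<theta> by (simp add: norm_mult)
      also have "\<dots> \<le> (2 * pi * 1) * \<eta>"
        using \<theta> B[of "\<gamma> \<theta>"] n\<gamma>[of \<theta>] elim(2) by (intro mult_mono) auto
      finally show "norm (- (2 * of_real pi * \<i> * of_real \<theta>) * \<gamma> \<theta> * fdot t (\<gamma> \<theta>)) \<le> 2 * pi * \<eta>"
        by simp
    qed simp
    also have "\<dots> < \<epsilon>" using \<epsilon> by (simp add: \<eta>_def)
    finally show ?case by simp
  qed
qed

text \<open>Otherwise \<open>f t z\<close> is asymptotic to \<open>1/z\<close>, and its integral over a large circle is close to \<open>2 \<pi> \<i>\<close>, although
  \<open>f t\<close> has the single-valued primitive \<open>R\<close>.\<close>

lemma degree_not_minus_one:
  assumes t: "t \<in> T"
  shows "(\<Sum>i\<in>I. e i) \<noteq> -1"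
proof
  assume deg: "(\<Sum>i\<in>I. e i) = -1"
  have "\<forall>\<^sub>F z in at_infinity. norm (f t z / z powi (-1) - 1) < 1 / 2"
    using tendstoD[OF factored_asymptotics_at_infinity[OF finite_I, of e "\<lambda>i. c i t"], of "1/2"]
    by (simp add: deg dist_norm)
  with eventually_beyond_poles[of t]
  have "\<forall>\<^sub>F z in at_infinity. (z \<noteq> 0 \<and> (\<forall>p\<in>poles t. norm p < norm z)) \<and> norm (f t z / z powi (-1) - 1) < 1 / 2"
    by eventually_elim simp
  then obtain B where B: "\<And>z. norm z \<ge> B \<Longrightarrow>
      (z \<noteq> 0 \<and> (\<forall>p\<in>poles t. norm p < norm z)) \<and> norm (f t z / z powi (-1) - 1) < 1 / 2"
    unfolding eventually_at_infinity by blast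
  define r where "r = \<bar>B\<bar> + 1"
  have r: "r > 0" "\<And>z :: complex. norm z = r \<Longrightarrow> norm z \<ge> B" by (auto simp: r_def)
  have "(f t has_contour_integral R (pathfinish (circlepath 0 r)) t - R (pathstart (circlepath 0 r)) t) (circlepath 0 r)"
  proof (rule contour_integral_primitive[where S = "sphere 0 r"])
    fix z assume "z \<in> sphere (0 :: complex) r"
    then have "z \<notin> poles t" using B[OF r(2)[of z]] by auto
    then show "((\<lambda>z. R z t) has_field_derivative f t z) (at z within sphere 0 r)"
      using R_deriv[OF t] has_field_derivative_at_within by blast
  qed (use r in auto)
  then have 0: "(f t has_contour_integral 0) (circlepath 0 r)" by simp
  have "((\<lambda>u. 1 / (u - 0)) has_contour_integral (2 * of_real pi * \<i> * 1)) (circlepath 0 r)"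
    by (rule Cauchy_integral_circlepath) (use r in auto)
  from has_contour_integral_diff[OF 0 this]
  have "((\<lambda>u. f t u - 1 / u) has_contour_integral - (2 * of_real pi * \<i>)) (circlepath 0 r)"
    by simp
  then have "norm (- (2 * of_real pi * \<i>)) \<le> 1 / (2 * r) * (2 * pi * r)"
  proof (rule has_contour_integral_bound_circlepath)
    fix z :: complex assume "norm (z - 0) = r"
    then have z: "norm z = r" "z \<noteq> 0" using r by auto
    have "f t z - 1 / z = (f t z / z powi (-1) - 1) / z"
      using z by (simp add: power_int_minus field_simps)
    also have "norm \<dots> \<le> (1 / 2) / r"
      unfolding norm_divide z(1) using B[OF r(2)[OF z(1)]] r(1) by (intro divide_right_mono) auto
    finally show "norm (f t z - 1 / z) \<le> 1 / (2 * r)" by simp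
  qed (use r in auto)
  then show False using r pi_gt_zero by (simp add: norm_mult)
qed

text \<open>The first alternative of the normalization anchors \<open>R\<close> at a zero of \<open>f\<close>, the second at infinity; either
  gives one point where \<open>R\<close> is differentiable in time. In the second alternative it moreover makes
  \<open>Rdot t\<close> vanish at infinity, as is required when \<open>f\<close> does not grow.\<close>

theorem divisor_motion:
  assumes t: "t \<in> T" and center: "\<And>s. s \<in> T \<Longrightarrow> (\<Sum>i\<in>I. of_int (e i) * c i s) = 0"
    and normalized: "((\<exists>i\<in>I. e i > 0 \<and> (\<forall>s\<in>T. R (c i s) s = 0)) \<and> (\<Sum>i\<in>I. e i) > 0) \<or>
      (\<exists>c\<^sub>0. \<forall>s\<in>T. ((\<lambda>z. R z s - c\<^sub>0 * z) \<longlongrightarrow> 0) at_infinity)"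
  shows "\<And>k. k \<in> I \<Longrightarrow> e k > 0 \<Longrightarrow>
      ((\<lambda>s. R (c k s) s) has_vector_derivative Rdot t (c k t)) (at t within T)" (is "PROP ?A")
    and "\<And>i. i \<in> I \<Longrightarrow> c' i t =
      (if e i > 0 then (deriv ^^ nat (e i)) (cofactor I e (\<lambda>i. c i t) i) (c i t) / fact (nat (e i))
          * Rdot t (c i t) else 0)
      + (\<Sum>k\<in>{k\<in>I. e k > 0} - {i}.
          (deriv ^^ (nat (e k) - 1)) (\<lambda>x. cofactor I e (\<lambda>i. c i t) k x / (x - c i t)) (c k t)
            / fact (nat (e k) - 1) * Rdot t (c k t))"
proof -
  have zero_not_pole: "c k t \<notin> poles t" if "k \<in> I" "e k > 0" for k
    using that inj_onD[OF c_inj[OF t], of k] by (force simp: poles_def)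
  have "((\<lambda>s. \<Sum>i\<in>I. of_int (e i) * c i s) has_vector_derivative (\<Sum>i\<in>I. of_int (e i) * c' i t)) (at t within T)"
    by (intro has_vector_derivative_sum has_vector_derivative_mult_right c_deriv t)
  then have "((\<lambda>s. 0) has_vector_derivative (\<Sum>i\<in>I. of_int (e i) * c' i t)) (at t within T)"
    by (rule has_vector_derivative_transform[OF t, rotated]) (simp add: center)
  then have center': "(\<Sum>i\<in>I. of_int (e i) * c' i t) = 0"
    using vector_derivative_unique_within[OF T_limit[OF t] _ has_vector_derivative_const] by blast
  have "\<exists>z. z \<notin> poles t \<and> R z differentiable (at t within T)"
    using normalized
  proof (elim disjE conjE exE bexE)
    fix i assume i: "i \<in> I" "e i > 0" and z: "\<forall>s\<in>T. R (c i s) s = 0"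
    have "((\<lambda>s. 0 - (R (c i s) s - R (c i t) s)) has_vector_derivative 0 - 0) (at t within T)"
      by (intro has_vector_derivative_diff has_vector_derivative_const moving_point_derivative t i)
    then have "(R (c i t) has_vector_derivative 0 - 0) (at t within T)"
      by (rule has_vector_derivative_transform[OF t, rotated]) (use z in simp)
    then show ?thesis
      using zero_not_pole[OF i] differentiableI_vector by blast
  next
    fix c\<^sub>0 assume lim: "\<forall>s\<in>T. ((\<lambda>z. R z s - c\<^sub>0 * z) \<longlongrightarrow> 0) at_infinity"
    obtain z :: complex where z: "z \<noteq> 0" "\<forall>p\<in>poles t. norm p < norm z"
      using eventually_happens[OF eventually_beyond_poles[of t]] trivial_limit_at_infinity by auto
    have "R z differentiable (at t within T)"
      by (rule differentiableI_vector[OF R_derivative_near_infinity[OF t]]) (use lim z in auto)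
    then show ?thesis using z by blast
  qed
  then have diff: "R z differentiable (at t within T)" if "z \<notin> poles t" for z
    using R_differentiable_transfer[OF t] that by blast
  show "PROP ?A"
  proof -
    fix k assume k: "k \<in> I" "e k > 0"
    have "((\<lambda>s. (R (c k s) s - R (c k t) s) + R (c k t) s) has_vector_derivative 0 + Rdot t (c k t)) (at t within T)"
      by (intro has_vector_derivative_add moving_point_derivative Rdot_works diff zero_not_pole t k)
    then show "((\<lambda>s. R (c k s) s) has_vector_derivative Rdot t (c k t)) (at t within T)" by simp
  qed
  fix i assume i: "i \<in> I"
  have "(Rdot t \<longlongrightarrow> 0) at_infinity" if deg: "(\<Sum>i\<in>I. e i) \<le> 0"
    using normalized Rdot_at_infinity[OF t _ deg center'] deg by force
  then show "c' i t =
      (if e i > 0 then (deriv ^^ nat (e i)) (cofactor I e (\<lambda>i. c i t) i) (c i t) / fact (nat (e i))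
          * Rdot t (c i t) else 0)
      + (\<Sum>k\<in>{k\<in>I. e k > 0} - {i}.
          (deriv ^^ (nat (e k) - 1)) (\<lambda>x. cofactor I e (\<lambda>i. c i t) k x / (x - c i t)) (c k t)
            / fact (nat (e k) - 1) * Rdot t (c k t))"
    by (intro velocity_from_critical_values[OF finite_I e_nonzero c_inj[OF t] _ refl center' _ i])
      (use Rdot_has_field_derivative[OF t diff] in \<open>auto simp: poles_def\<close>)
qed

end

section \<open>Rational functions with prescribed critical points and poles\<close>

lemma smooth_on_interval_imp_C1:
  assumes "smooth_on_interval T g"
  shows "\<exists>g'. (\<forall>t\<in>T. (g has_vector_derivative g' t) (at t within T)) \<and> continuous_on T g'"
proof -
  obtain D where D: "D 0 = g"
      "\<And>i t. t \<in> T \<Longrightarrow> (D i has_vector_derivative D (Suc i) t) (at t within T)"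
    using assms unfolding smooth_on_interval_def by blast
  have "continuous_on T (D 1)"
    unfolding continuous_on_eq_continuous_within using D(2)[of _ 1] has_vector_derivative_continuous by blast
  then show ?thesis using D(2)[of _ 0] D(1) by (intro exI[of _ "D 1"]) simp
qed

text \<open>The integral from \<open>w\<close> to \<open>z\<close> is \<open>G z - G w\<close>, so the improper integral can equal \<open>G z\<close> only if \<open>G w\<close>
  tends to \<open>0\<close>. The paths exist because the complement of a finite set is connected.\<close>

lemma primitive_vanishes_at_infinity:
  fixes G F :: "complex \<Rightarrow> complex"
  assumes fin: "finite P" and der: "\<And>z. z \<notin> P \<Longrightarrow> (G has_field_derivative F z) (at z)"
    and int: "\<And>z. z \<notin> P \<Longrightarrow> has_integral_from_infinity F (- P) z (G z)"
  shows "(G \<longlongrightarrow> 0) at_infinity"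
proof -
  obtain z where z: "z \<notin> P"
    using ex_new_if_finite[OF infinite_UNIV_char_0 fin] by blast
  have op: "open (- P)" "connected (- P)"
    using finite_imp_closed[OF fin] connected_open_delete_finite[of UNIV P] fin
    by (auto simp: Compl_eq_Diff_UNIV connected_UNIV)
  have "\<forall>w. \<exists>g. w \<in> - P \<longrightarrow> valid_path g \<and> path_image g \<subseteq> - P \<and> pathstart g = w \<and> pathfinish g = z"
    using connected_open_polynomial_connected[OF op] z valid_path_polynomial_function by (metis ComplI)
  then obtain g where g: "\<And>w. w \<in> - P \<Longrightarrow>
      valid_path (g w) \<and> path_image (g w) \<subseteq> - P \<and> pathstart (g w) = w \<and> pathfinish (g w) = z"
    by metis
  then have lim: "((\<lambda>w. contour_integral (g w) F) \<longlongrightarrow> G z) at_infinity"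
    using int[OF z] unfolding has_integral_from_infinity_def by blast
  have "contour_integral (g w) F = G z - G w" if "w \<notin> P" for w
  proof -
    have "(F has_contour_integral G (pathfinish (g w)) - G (pathstart (g w))) (g w)"
      using g[of w] that der
      by (intro contour_integral_primitive[where S = "- P"]) (auto intro: has_field_derivative_at_within)
    then show ?thesis using g[of w] that by (simp add: contour_integral_unique)
  qed
  moreover have "\<forall>\<^sub>F w in at_infinity. \<forall>p\<in>P. w \<noteq> p"
    using fin by (intro eventually_ball_finite) (auto simp: eventually_not_equal_at_infinity)
  ultimately have "\<forall>\<^sub>F w in at_infinity. G z - contour_integral (g w) F = G w"
    by (elim eventually_mono) (metis diff_diff_eq2 diff_add_cancel add_diff_cancel_left')
  moreover have "((\<lambda>w. G z - contour_integral (g w) F) \<longlongrightarrow> G z - G z) at_infinity"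
    by (intro tendsto_intros lim)
  ultimately show ?thesis
    by (elim tendsto_transform_eq[rotated]) auto
qed

lemma Plus_minus_Inl: "(A <+> B) - {Inl x} = (A - {x}) <+> B"
  by (auto simp: Plus_def)

lemma inj_on_case_sum:
  assumes "inj_on f A" "inj_on g B" "\<And>x y. x \<in> A \<Longrightarrow> y \<in> B \<Longrightarrow> f x \<noteq> g y"
  shows "inj_on (case_sum f g) (A <+> B)"
proof (rule inj_onI)
  fix x y assume "x \<in> A <+> B" "y \<in> A <+> B" "case_sum f g x = case_sum f g y"
  then show "x = y"
    by (elim PlusE) (use assms in \<open>auto dest: inj_onD\<close>, metis+)
qed

text \<open>The left summand of \<open>nat + nat\<close> indexes the critical points, the right one the poles.\<close>

definition exponent :: "(nat \<Rightarrow> nat) \<Rightarrow> (nat \<Rightarrow> nat) \<Rightarrow> nat + nat \<Rightarrow> int" where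
  "exponent m n = case_sum (\<lambda>l. int (m l - 1)) (\<lambda>j. - int (n j + 1))"

lemma exponent_simps [simp]:
  "exponent m n (Inl l) = int (m l - 1)" "exponent m n (Inr j) = - int (n j + 1)"
  by (simp_all add: exponent_def)

lemma factored_eq_R_prime:
  "factored ({1..M} <+> {1..N}) (exponent m n) (case_sum a b) = R_prime M N m n a b"
  unfolding factored_def R_prime_def fun_eq_iff
  by (simp add: prod.Plus o_def power_int_minus prod_inversef[symmetric] divide_inverse
      del: power_Suc of_nat_Suc of_nat_add)

lemma cofactor_eq_H_fun:
  "cofactor ({1..M} <+> {1..N}) (exponent m n) (case_sum a b) (Inl k) = H_fun M N m n a b k"
  unfolding cofactor_def factored_def H_fun_def fun_eq_iff Plus_minus_Inl
  by (simp add: prod.Plus o_def power_int_minus prod_inversef[symmetric] divide_inverse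
      del: power_Suc of_nat_Suc of_nat_add)

theorem mainTheorem2:
  fixes T :: "real set"
    and M N :: nat
    and m n :: "nat \<Rightarrow> nat"
    and a b A :: "nat \<Rightarrow> real \<Rightarrow> complex"
    and R :: "complex \<Rightarrow> real \<Rightarrow> complex"
  assumes interval: "is_interval T" "interior T \<noteq> {}"
    and mult_crit: "\<And>l. l \<in> {1..M} \<Longrightarrow> m l \<ge> 2"
    and mult_pole: "\<And>j. j \<in> {1..N} \<Longrightarrow> n j \<ge> 1"
    and smooth_a: "\<And>l. l \<in> {1..M} \<Longrightarrow> smooth_on_interval T (a l)"
    and smooth_b: "\<And>j. j \<in> {1..N} \<Longrightarrow> smooth_on_interval T (b j)"
    and distinct_a: "\<And>t. t \<in> T \<Longrightarrow> inj_on (\<lambda>l. a l t) {1..M}"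
    and distinct_b: "\<And>t. t \<in> T \<Longrightarrow> inj_on (\<lambda>j. b j t) {1..N}"
    and distinct_ab: "\<And>t l j. t \<in> T \<Longrightarrow> l \<in> {1..M} \<Longrightarrow> j \<in> {1..N} \<Longrightarrow> a l t \<noteq> b j t"
    and rational: "\<And>t. t \<in> T \<Longrightarrow> rational_function (\<lambda>z. R z t)"
    and poles: "\<And>t. t \<in> T \<Longrightarrow> {z. is_pole (\<lambda>z. R z t) z} = (\<lambda>j. b j t) ` {1..N}"
    and pole_order: "\<And>t j. t \<in> T \<Longrightarrow> j \<in> {1..N} \<Longrightarrow> zorder (\<lambda>z. R z t) (b j t) = - int (n j)"
    and crit: "\<And>t. t \<in> T \<Longrightarrow>
        {z. \<not> is_pole (\<lambda>z. R z t) z \<and> deriv (\<lambda>z. R z t) z = 0} = (\<lambda>l. a l t) ` {1..M}"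
    and crit_order: "\<And>t l. t \<in> T \<Longrightarrow> l \<in> {1..M} \<Longrightarrow>
        zorder (deriv (\<lambda>z. R z t)) (a l t) = int (m l - 1)"
    and R_deriv: "\<And>t z. t \<in> T \<Longrightarrow> z \<notin> (\<lambda>j. b j t) ` {1..N} \<Longrightarrow>
        ((\<lambda>z. R z t) has_field_derivative
          R_prime M N m n (\<lambda>l. a l t) (\<lambda>j. b j t) z) (at z)"
    and norm_gt: "\<And>t z. crit_total M m > pole_total N n \<Longrightarrow> t \<in> T \<Longrightarrow>
        z \<notin> (\<lambda>j. b j t) ` {1..N} \<Longrightarrow>
        has_integral_from (R_prime M N m n (\<lambda>l. a l t) (\<lambda>j. b j t))
          (- ((\<lambda>j. b j t) ` {1..N})) (a 1 t) z (R z t)"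
    and norm_lt: "\<And>t z. crit_total M m + 1 < pole_total N n \<Longrightarrow> t \<in> T \<Longrightarrow>
        z \<notin> (\<lambda>j. b j t) ` {1..N} \<Longrightarrow>
        has_integral_from_infinity (R_prime M N m n (\<lambda>l. a l t) (\<lambda>j. b j t))
          (- ((\<lambda>j. b j t) ` {1..N})) z (R z t)"
    and norm_eq: "\<And>t z. crit_total M m = pole_total N n \<Longrightarrow> t \<in> T \<Longrightarrow>
        z \<notin> (\<lambda>j. b j t) ` {1..N} \<Longrightarrow>
        has_integral_from_infinity (\<lambda>\<zeta>. R_prime M N m n (\<lambda>l. a l t) (\<lambda>j. b j t) \<zeta> - 1)
          (- ((\<lambda>j. b j t) ` {1..N})) z (R z t - z)"
    and centered: "\<And>t. t \<in> T \<Longrightarrow>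
        (\<Sum>k=1..M. of_nat (m k - 1) * a k t) - (\<Sum>j=1..N. of_nat (n j + 1) * b j t) = 0"
    and crit_values: "\<And>t l. t \<in> T \<Longrightarrow> l \<in> {1..M} \<Longrightarrow> A l t = R (a l t) t"
  shows "\<forall>t\<in>T.
      (\<forall>k\<in>{1..M}. A k differentiable (at t within T)) \<and>
      (\<forall>l\<in>{1..M}. (a l has_vector_derivative
          ((deriv ^^ (m l - 1)) (H_fun M N m n (\<lambda>i. a i t) (\<lambda>j. b j t) l) (a l t)
              / fact (m l - 1) * vector_derivative (A l) (at t within T)
           + (\<Sum>k\<in>{1..M} - {l}.
                (deriv ^^ (m k - 2)) (G_fun M N m n (\<lambda>i. a i t) (\<lambda>j. b j t) k l) (a k t)
                  / fact (m k - 2) * vector_derivative (A k) (at t within T))))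
          (at t within T)) \<and>
      (\<forall>j\<in>{1..N}. (b j has_vector_derivative
          (\<Sum>k=1..M.
              (deriv ^^ (m k - 2)) (I_fun M N m n (\<lambda>i. a i t) (\<lambda>j. b j t) k j) (a k t)
                / fact (m k - 2) * vector_derivative (A k) (at t within T)))
          (at t within T))"
proof -
  let ?I = "{1..M} <+> {1..N}" and ?e = "exponent m n"
  define c where "c = case_sum a b"
  have c_at: "(\<lambda>i. c i t) = case_sum (\<lambda>l. a l t) (\<lambda>j. b j t)" for t
    by (auto simp: c_def fun_eq_iff split: sum.split)
  have "\<exists>g'. (\<forall>t\<in>T. (c i has_vector_derivative g' t) (at t within T)) \<and> continuous_on T g'"
    if "i \<in> ?I" for i
    using that smooth_on_interval_imp_C1[OF smooth_a] smooth_on_interval_imp_C1[OF smooth_b]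
    by (auto simp: c_def)
  then obtain c' where c': "\<And>i t. i \<in> ?I \<Longrightarrow> t \<in> T \<Longrightarrow> (c i has_vector_derivative c' i t) (at t within T)"
      "\<And>i. i \<in> ?I \<Longrightarrow> continuous_on T (c' i)"
    by metis
  have zeros: "{i\<in>?I. ?e i > 0} = Inl ` {1..M}"
    using mult_crit by fastforce
  have pole_idx: "{i\<in>?I. ?e i < 0} = Inr ` {1..N}"
    by fastforce
  have poles_at: "(\<lambda>i. c i t) ` {i\<in>?I. ?e i < 0} = (\<lambda>j. b j t) ` {1..N}" for t
    unfolding pole_idx by (simp add: c_def image_image)
  have T_limit: "at t within T \<noteq> bot" if "t \<in> T" for t
  proof -
    have "T \<noteq> {x}" for x using interval(2) by auto
    then show ?thesis
      using connected_imp_perfect[of T t] that interval(1)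
      by (simp add: is_interval_connected trivial_limit_within)
  qed
  interpret F: divisor_family T ?I ?e c c' R
  proof
    show "convex T" using interval(1) by (rule is_interval_convex)
    show "?e i \<noteq> 0" if "i \<in> ?I" for i
      using that mult_crit by fastforce
    show "inj_on (\<lambda>i. c i t) ?I" if "t \<in> T" for t
      unfolding c_at
      by (rule inj_on_case_sum[OF distinct_a[OF that] distinct_b[OF that] distinct_ab[OF that]])
    show "((\<lambda>z. R z t) has_field_derivative factored ?I ?e (\<lambda>i. c i t) z) (at z)"
      if "t \<in> T" "z \<notin> (\<lambda>i. c i t) ` {i\<in>?I. ?e i < 0}" for t z
      using R_deriv[OF that(1) that(2)[unfolded poles_at]] unfolding c_at factored_eq_R_prime .
  qed (use T_limit c' in simp_all)
  have degree: "(\<Sum>i\<in>?I. ?e i) = int (crit_total M m) - int (pole_total N n)"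
    by (simp add: sum.Plus o_def crit_total_def pole_total_def sum_negf del: of_nat_add of_nat_Suc)
  have center: "(\<Sum>i\<in>?I. of_int (?e i) * c i s) = 0" if "s \<in> T" for s
    using centered[OF that] by (simp add: sum.Plus o_def c_def sum_negf del: of_nat_add of_nat_Suc)
  show ?thesis
  proof (rule ballI)
    fix t assume t: "t \<in> T"
    consider (gt) "crit_total M m > pole_total N n" | (lt) "crit_total M m + 1 < pole_total N n"
      | (eq) "crit_total M m = pole_total N n"
      using F.degree_not_minus_one[OF t] unfolding degree by linarith
    then have normalized: "((\<exists>i\<in>?I. ?e i > 0 \<and> (\<forall>s\<in>T. R (c i s) s = 0)) \<and> (\<Sum>i\<in>?I. ?e i) > 0) \<or>
      (\<exists>c\<^sub>0. \<forall>s\<in>T. ((\<lambda>z. R z s - c\<^sub>0 * z) \<longlongrightarrow> 0) at_infinity)"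
    proof cases
      case gt
      then have M: "1 \<in> {1..M}" by (cases M) (auto simp: crit_total_def)
      have "R (a 1 s) s = 0" if s: "s \<in> T" for s
      proof -
        have nb: "a 1 s \<notin> (\<lambda>j. b j s) ` {1..N}"
          using distinct_ab[OF s M] by blast
        let ?p = "linepath (a 1 s) (a 1 s)"
        have "valid_path ?p \<and> path_image ?p \<subseteq> - ((\<lambda>j. b j s) ` {1..N})
            \<and> pathstart ?p = a 1 s \<and> pathfinish ?p = a 1 s"
          using nb by simp
        then have "(R_prime M N m n (\<lambda>l. a l s) (\<lambda>j. b j s) has_contour_integral R (a 1 s) s) ?p"
          using norm_gt[OF gt s nb] unfolding has_integral_from_def by blast
        then show ?thesis
          using has_contour_integral_trivial has_contour_integral_unique by blast
      qed
      moreover have "Inl 1 \<in> ?I" "?e (Inl 1) > 0" using M mult_crit[OF M] by auto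
      moreover have "(\<Sum>i\<in>?I. ?e i) > 0" using gt unfolding degree by simp
      ultimately show ?thesis
        by (intro disjI1 conjI bexI[of _ "Inl 1"]) (auto simp: c_def)
    next
      case lt
      have "((\<lambda>z. R z s - 0 * z) \<longlongrightarrow> 0) at_infinity" if s: "s \<in> T" for s
        by (rule primitive_vanishes_at_infinity[where P = "(\<lambda>j. b j s) ` {1..N}"])
          (use R_deriv[OF s] norm_lt[OF lt s] in auto)
      then show ?thesis by blast
    next
      case eq
      have "((\<lambda>z. R z s - 1 * z) \<longlongrightarrow> 0) at_infinity" if s: "s \<in> T" for s
        by (rule primitive_vanishes_at_infinity[where P = "(\<lambda>j. b j s) ` {1..N}"])
          (use R_deriv[OF s] norm_eq[OF eq s] in \<open>auto intro!: derivative_eq_intros\<close>)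
      then show ?thesis by blast
    qed
    have A_deriv: "(A k has_vector_derivative F.Rdot t (c (Inl k) t)) (at t within T)" if k: "k \<in> {1..M}" for k
    proof -
      have "((\<lambda>s. R (c (Inl k) s) s) has_vector_derivative F.Rdot t (c (Inl k) t)) (at t within T)"
        by (rule F.divisor_motion(1)[OF t center normalized]) (use k mult_crit[OF k] in auto)
      then show ?thesis
        by (rule has_vector_derivative_transform[OF t, rotated]) (simp add: crit_values[OF _ k] c_def)
    qed
    have A': "vector_derivative (A k) (at t within T) = F.Rdot t (c (Inl k) t)" if "k \<in> {1..M}" for k
      using vector_derivative_within[OF T_limit[OF t] A_deriv[OF that]] .
    let ?H = "H_fun M N m n (\<lambda>i. a i t) (\<lambda>j. b j t)"
    have motion: "c' i t =
      (if ?e i > 0 then (deriv ^^ nat (?e i)) (cofactor ?I ?e (\<lambda>i. c i t) i) (c i t) / fact (nat (?e i))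
          * F.Rdot t (c i t) else 0)
      + (\<Sum>k\<in>Inl ` {1..M} - {i}.
          (deriv ^^ (nat (?e k) - 1)) (\<lambda>x. cofactor ?I ?e (\<lambda>i. c i t) k x / (x - c i t)) (c k t)
            / fact (nat (?e k) - 1) * F.Rdot t (c k t))" if "i \<in> ?I" for i
      using F.divisor_motion(2)[OF t center normalized that] unfolding zeros by simp
    have other: "(\<Sum>k\<in>Inl ` X. (deriv ^^ (nat (?e k) - 1)) (\<lambda>x. cofactor ?I ?e (\<lambda>i. c i t) k x / (x - y)) (c k t)
            / fact (nat (?e k) - 1) * F.Rdot t (c k t))
        = (\<Sum>k\<in>X. (deriv ^^ (m k - 2)) (\<lambda>x. ?H k x / (x - y)) (a k t) / fact (m k - 2)
            * vector_derivative (A k) (at t within T))" if "X \<subseteq> {1..M}" for X y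
      unfolding sum.reindex[OF inj_Inl]
    proof (rule sum.cong)
      fix k assume "k \<in> X"
      then have k: "k \<in> {1..M}" using that by blast
      have "nat (?e (Inl k)) - 1 = m k - 2" by simp
      then show "((\<lambda>k. (deriv ^^ (nat (?e k) - 1)) (\<lambda>x. cofactor ?I ?e (\<lambda>i. c i t) k x / (x - y)) (c k t)
            / fact (nat (?e k) - 1) * F.Rdot t (c k t)) \<circ> Inl) k
          = (deriv ^^ (m k - 2)) (\<lambda>x. ?H k x / (x - y)) (a k t) / fact (m k - 2)
            * vector_derivative (A k) (at t within T)"
        unfolding o_def c_at cofactor_eq_H_fun A'[OF k] by (simp add: c_def)
    qed simp
    have "c' (Inl l) t = (deriv ^^ (m l - 1)) (?H l) (a l t) / fact (m l - 1)
          * vector_derivative (A l) (at t within T)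
        + (\<Sum>k\<in>{1..M} - {l}. (deriv ^^ (m k - 2)) (\<lambda>x. ?H k x / (x - a l t)) (a k t)
            / fact (m k - 2) * vector_derivative (A k) (at t within T))" if l: "l \<in> {1..M}" for l
    proof -
      have "Inl ` {1..M} - {Inl l :: nat + nat} = Inl ` ({1..M} - {l})" by auto
      moreover have "?e (Inl l) > 0" "nat (?e (Inl l)) = m l - 1" "c (Inl l) t = a l t"
        using mult_crit[OF l] by (simp_all add: c_def)
      moreover have "cofactor ?I ?e (\<lambda>i. c i t) (Inl l) = ?H l"
        unfolding c_at cofactor_eq_H_fun ..
      moreover have "Inl l \<in> ?I" using l by blast
      ultimately show ?thesis
        using motion[of "Inl l"] A'[OF l] other[of "{1..M} - {l}" "a l t"] by simp
    qed
    moreover have "c' (Inr j) t = (\<Sum>k=1..M. (deriv ^^ (m k - 2)) (\<lambda>x. ?H k x / (x - b j t)) (a k t)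
            / fact (m k - 2) * vector_derivative (A k) (at t within T))" if j: "j \<in> {1..N}" for j
    proof -
      have "Inl ` {1..M} - {Inr j :: nat + nat} = Inl ` {1..M}" by auto
      moreover have "\<not> ?e (Inr j) > 0" "c (Inr j) t = b j t"
        by (simp_all add: c_def)
      moreover have "Inr j \<in> ?I" using j by blast
      ultimately show ?thesis
        using motion[of "Inr j"] other[of "{1..M}" "b j t"] by simp
    qed
    moreover have "(a l has_vector_derivative c' (Inl l) t) (at t within T)" if "l \<in> {1..M}" for l
      using c'(1)[OF InlI[OF that] t] by (simp add: c_def)
    moreover have "(b j has_vector_derivative c' (Inr j) t) (at t within T)" if "j \<in> {1..N}" for j
      using c'(1)[OF InrI[OF that] t] by (simp add: c_def)
    ultimately show "(\<forall>k\<in>{1..M}. A k differentiable (at t within T)) \<and>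
      (\<forall>l\<in>{1..M}. (a l has_vector_derivative
          ((deriv ^^ (m l - 1)) (H_fun M N m n (\<lambda>i. a i t) (\<lambda>j. b j t) l) (a l t)
              / fact (m l - 1) * vector_derivative (A l) (at t within T)
           + (\<Sum>k\<in>{1..M} - {l}.
                (deriv ^^ (m k - 2)) (G_fun M N m n (\<lambda>i. a i t) (\<lambda>j. b j t) k l) (a k t)
                  / fact (m k - 2) * vector_derivative (A k) (at t within T))))
          (at t within T)) \<and>
      (\<forall>j\<in>{1..N}. (b j has_vector_derivative
          (\<Sum>k=1..M.
              (deriv ^^ (m k - 2)) (I_fun M N m n (\<lambda>i. a i t) (\<lambda>j. b j t) k j) (a k t)
                / fact (m k - 2) * vector_derivative (A k) (at t within T)))
          (at t within T))"
      unfolding G_fun_def[abs_def] I_fun_def[abs_def]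
      using differentiableI_vector[OF A_deriv] by simp
  qed
qed

end
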